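(* Let $X$ be a ball Banach function space on $\mathbb{R}$, $p\in[1,\infty)$, $\gamma\in(-\infty,0)$, and $q\in(0,-p\gamma)$. Assume that $X^{1/p}$ is a ball Banach function space and that the Hardy--Littlewood maximal operator $\mathcal{M}$ is bounded on $(X^{1/p})'$. Then for every $f\in C^1(\mathbb{R})$ with $f'\in C_{\mathrm c}(\mathbb{R})$, $$\limsup_{\lambda\to0^+}\lambda\left\|\left[\int_{\mathbb{R}}\mathbf{1}_{E_{\lambda,\gamma/q}[f]}(\cdot,y)|\cdot-y|^{\gamma-1}dy\right]^{1/q}\right\|_X\le\left[-\frac{\kappa(q,1)}{\gamma}\right]^{1/q}\|f'\|_X.$$
   Context: A quasi-Banach space $X$ of measurable functions on $\mathbb{R}$ with quasi-norm defined on all measurable functions is a ball quasi-Banach function space if: $\|f\|_X=0$ implies $f=0$ a.e.; $|g|\le|f|$ a.e. implies $\|g\|_X\le\|f\|_X$; $0\le f_m\uparrow f$ a.e. implies $\|f_m\|_X\uparrow\|f\|_X$; $\mathbf{1}_B\in X$ for every bounded interval $B$. It is a ball Banach function space if moreover the triangle inequality holds and for every bounded interval $B$ there is $C_B$ with $\int_B|f|\le C_B\|f\|_X$. For $t>0$, $X^t:=\{f:|f|^t\in X\}$ with $\|f\|_{X^t}:=\|\,|f|^t\|_X^{1/t}$. Associate space: $Y':=\{f:\|f\|_{Y'}:=\sup_{\|g\|_Y=1}\|fg\|_{L^1}<\infty\}$. $\mathcal{M}$ is the Hardy--Littlewood maximal operator. $E_{\lambda,\beta}[f]:=\{(x,y)\in\mathbb{R}^2:x\ne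 y,\ |f(x)-f(y)|/|x-y|^{1+\beta}>\lambda\}$. $\kappa(q,1):=\int_{\mathbb{S}^0}|e\cdot\omega|^q\,d\omega=2$ (counting measure on $\{-1,1\}$). *)

theory Defs
  imports "HOL-Analysis.Analysis"
begin

type_synonym fnorm = "(real \<Rightarrow> real) \<Rightarrow> ennreal"

definition meas_fun :: "(real \<Rightarrow> real) \<Rightarrow> bool" where
  "meas_fun f \<longleftrightarrow> f \<in> borel_measurable lebesgue"

definition bounded_interval :: "real set \<Rightarrow> bool" where
  "bounded_interval B \<longleftrightarrow> is_interval B \<and> bounded B"

text \<open>Quasi-Banach space structure on X = {f measurable. N f < \<infinity>} with quasi-triangle constant K.\<close>
definition quasi_banach_with :: "fnorm \<Rightarrow> real \<Rightarrow> bool" where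
  "quasi_banach_with N K \<longleftrightarrow>
     K \<ge> 1 \<and>
     (\<forall>f c. meas_fun f \<longrightarrow> N (\<lambda>x. c * f x) = ennreal \<bar>c\<bar> * N f) \<and>
     (\<forall>f g. meas_fun f \<longrightarrow> meas_fun g \<longrightarrow> N (\<lambda>x. f x + g x) \<le> ennreal K * (N f + N g)) \<and>
     (\<forall>u :: nat \<Rightarrow> real \<Rightarrow> real.
        (\<forall>n. meas_fun (u n) \<and> N (u n) < \<infinity>) \<and>
        (\<forall>e>0. \<exists>M. \<forall>m\<ge>M. \<forall>n\<ge>M. N (\<lambda>x. u m x - u n x) < ennreal e)
        \<longrightarrow> (\<exists>g. meas_fun g \<and> N g < \<infinity> \<and> (\<lambda>n. N (\<lambda>x. u n x - g x)) \<longlonglongrightarrow> 0))"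

definition ball_function_axioms :: "fnorm \<Rightarrow> bool" where
  "ball_function_axioms N \<longleftrightarrow>
     (\<forall>f. meas_fun f \<longrightarrow> N f = 0 \<longrightarrow> (AE x in lebesgue. f x = 0)) \<and>
     (\<forall>f g. meas_fun f \<longrightarrow> meas_fun g \<longrightarrow> (AE x in lebesgue. \<bar>g x\<bar> \<le> \<bar>f x\<bar>) \<longrightarrow> N g \<le> N f) \<and>
     (\<forall>(fs :: nat \<Rightarrow> real \<Rightarrow> real) f. (\<forall>n. meas_fun (fs n)) \<longrightarrow> meas_fun f \<longrightarrow>
        (AE x in lebesgue. (\<forall>n. 0 \<le> fs n x \<and> fs n x \<le> fs (Suc n) x) \<and> (\<lambda>n. fs n x) \<longlonglongrightarrow> f x)
        \<longrightarrow> (\<lambda>n. N (fs n)) \<longlonglongrightarrow> N f) \<and>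
     (\<forall>B. bounded_interval B \<longrightarrow> N (indicator B) < \<infinity>)"

definition ball_qbfs :: "fnorm \<Rightarrow> bool" where
  "ball_qbfs N \<longleftrightarrow> (\<exists>K. quasi_banach_with N K) \<and> ball_function_axioms N"

definition ball_bfs :: "fnorm \<Rightarrow> bool" where
  "ball_bfs N \<longleftrightarrow> quasi_banach_with N 1 \<and> ball_function_axioms N \<and>
     (\<forall>B. bounded_interval B \<longrightarrow> (\<exists>C::real. \<forall>f. meas_fun f \<longrightarrow>
        (\<integral>\<^sup>+x\<in>B. ennreal \<bar>f x\<bar> \<partial>lebesgue) \<le> ennreal C * N f))"

text \<open>Power of an extended nonnegative real (exponent r > 0), \<infinity> powr r = \<infinity>.\<close>
definition enn_powr :: "ennreal \<Rightarrow> real \<Rightarrow> ennreal" where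
  "enn_powr a r = (if a = \<infinity> then \<infinity> else ennreal (enn2real a powr r))"

definition power_norm :: "fnorm \<Rightarrow> real \<Rightarrow> fnorm" where
  "power_norm N t f = enn_powr (N (\<lambda>x. \<bar>f x\<bar> powr t)) (1 / t)"

definition assoc_norm :: "fnorm \<Rightarrow> fnorm" where
  "assoc_norm N f = (SUP g\<in>{g. meas_fun g \<and> N g = 1}. \<integral>\<^sup>+x. ennreal \<bar>f x * g x\<bar> \<partial>lebesgue)"

definition ext_norm :: "fnorm \<Rightarrow> (real \<Rightarrow> ennreal) \<Rightarrow> ennreal" where
  "ext_norm N g = (if AE x in lebesgue. g x < \<infinity> then N (\<lambda>x. enn2real (g x)) else \<infinity>)"

definition hl_max :: "(real \<Rightarrow> real) \<Rightarrow> real \<Rightarrow> ennreal" where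
  "hl_max f x = (SUP ab\<in>{(a, b). a < x \<and> x < b}.
      (\<integral>\<^sup>+y\<in>{fst ab<..<snd ab}. ennreal \<bar>f y\<bar> \<partial>lebesgue) / ennreal (snd ab - fst ab))"

definition maximal_bounded_on :: "fnorm \<Rightarrow> bool" where
  "maximal_bounded_on N \<longleftrightarrow> (\<exists>C::real. \<forall>f. meas_fun f \<longrightarrow> N f < \<infinity> \<longrightarrow>
      ext_norm N (hl_max f) \<le> ennreal C * N f)"

definition E_set :: "real \<Rightarrow> real \<Rightarrow> (real \<Rightarrow> real) \<Rightarrow> (real \<times> real) set" where
  "E_set lam \<beta> f = {(x, y). x \<noteq> y \<and> \<bar>f x - f y\<bar> / \<bar>x - y\<bar> powr (1 + \<beta>) > lam}"

text \<open>\<kappa>(q,1) = integral over S^0 = {-1,1} (counting measure) of |e \<cdot> \<omega>|^q, with e = 1.\<close>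
definition kappa1 :: "real \<Rightarrow> real" where
  "kappa1 q = (\<Sum>\<omega>\<in>{-1, 1::real}. \<bar>1 * \<omega>\<bar> powr q)"

end

theory Submission
  imports Defs
begin

text \<open>Split the inner integral at \<open>\<bar>x - y\<bar> = \<delta>\<close>. Near the support of \<open>f'\<close> the part with
  \<open>\<bar>x - y\<bar> < \<delta>\<close> lives where \<open>\<bar>x - y\<bar>\<close> exceeds roughly \<open>(\<lambda> / \<bar>f' x\<bar>) powr (- q / \<gamma>)\<close>, which
  produces the main term \<open>(- 2 / \<gamma>) powr (1 / q) * \<bar>f' x\<bar>\<close>; everything else is \<open>O(\<lambda>)\<close>, with the tail
  \<open>\<bar>x\<bar> powr (\<gamma> / q)\<close> away from the support. So the theorem reduces to the fact that this tail has
  finite norm, that is, \<open>\<bar>x\<bar> powr (- s)\<close> lies in \<open>Y = X\<^bsup>1/p\<^esup>\<close> near infinity, where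
  \<open>s = - p \<gamma> / q > 1\<close>. By dyadic decomposition it is enough that the norm in \<open>Y\<close> of the indicator of
  \<open>(-r, r)\<close> grows at most linearly. If it did not, a separating functional \<open>g \<ge> 0\<close> supported
  in \<open>(-r, r)\<close> (a special case of the Lorentz--Luxemburg theorem) would have small norm in \<open>Y'\<close>
  compared with its integral, while its maximal function is at least \<open>\<integral>g / (2 r)\<close> on \<open>(-1, 1)\<close>,
  contradicting the boundedness of the maximal operator on \<open>Y'\<close>.\<close>

section \<open>Ball Banach function norms\<close>

lemma meas_funD: "meas_fun f \<Longrightarrow> f \<in> borel_measurable lebesgue"
  by (simp add: meas_fun_def)

lemma bfs_scale:
  assumes "ball_bfs N" "meas_fun f"
  shows "N (\<lambda>x. c * f x) = ennreal \<bar>c\<bar> * N f"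
proof -
  have "\<forall>f c. meas_fun f \<longrightarrow> N (\<lambda>x. c * f x) = ennreal \<bar>c\<bar> * N f"
    using assms(1) unfolding ball_bfs_def quasi_banach_with_def by (elim conjE)
  with assms(2) show ?thesis by simp
qed

lemma bfs_triangle:
  assumes "ball_bfs N" "meas_fun f" "meas_fun g"
  shows "N (\<lambda>x. f x + g x) \<le> N f + N g"
proof -
  have "\<forall>f g. meas_fun f \<longrightarrow> meas_fun g \<longrightarrow> N (\<lambda>x. f x + g x) \<le> ennreal 1 * (N f + N g)"
    using assms(1) unfolding ball_bfs_def quasi_banach_with_def by (elim conjE)
  from this[rule_format, OF assms(2,3)] show ?thesis by simp
qed

lemma bfs_mono_AE:
  assumes "ball_bfs N" "meas_fun f" "meas_fun g" "AE x in lebesgue. \<bar>g x\<bar> \<le> \<bar>f x\<bar>"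
  shows "N g \<le> N f"
proof -
  have "\<forall>f g. meas_fun f \<longrightarrow> meas_fun g \<longrightarrow> (AE x in lebesgue. \<bar>g x\<bar> \<le> \<bar>f x\<bar>) \<longrightarrow> N g \<le> N f"
    using assms(1) unfolding ball_bfs_def ball_function_axioms_def by (elim conjE)
  from this[rule_format, OF assms(2-4)] show ?thesis .
qed

lemma bfs_mono:
  "ball_bfs N \<Longrightarrow> meas_fun f \<Longrightarrow> meas_fun g \<Longrightarrow> (\<And>x. \<bar>g x\<bar> \<le> \<bar>f x\<bar>) \<Longrightarrow> N g \<le> N f"
  by (rule bfs_mono_AE[of N f g]) auto

lemma bfs_zero: "ball_bfs N \<Longrightarrow> N (\<lambda>x. 0) = 0"
  using bfs_scale[of N "\<lambda>x. 0" 0] by (simp add: meas_fun_def)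

lemma bfs_eq_0_AE:
  assumes "ball_bfs N" "meas_fun f" "N f = 0"
  shows "AE x in lebesgue. f x = 0"
proof -
  have "\<forall>f. meas_fun f \<longrightarrow> N f = 0 \<longrightarrow> (AE x in lebesgue. f x = 0)"
    using assms(1) unfolding ball_bfs_def ball_function_axioms_def by (elim conjE)
  from this[rule_format, OF assms(2,3)] show ?thesis .
qed

lemma bfs_indicator_finite:
  assumes "ball_bfs N" "bounded_interval B"
  shows "N (indicator B) < \<infinity>"
proof -
  have "\<forall>B. bounded_interval B \<longrightarrow> N (indicator B) < \<infinity>"
    using assms(1) unfolding ball_bfs_def ball_function_axioms_def by (elim conjE)
  from this[rule_format, OF assms(2)] show ?thesis .
qed

lemma bfs_Fatou_mono:
  assumes "ball_bfs N" "\<And>n. meas_fun (fs n)" "meas_fun f"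
    and "\<And>n x. 0 \<le> fs n x" "\<And>n x. fs n x \<le> fs (Suc n) x" "\<And>x. (\<lambda>n. fs n x) \<longlonglongrightarrow> f x"
    and "\<And>n. N (fs n) \<le> K"
  shows "N f \<le> K"
proof -
  have *: "\<forall>(fs :: nat \<Rightarrow> real \<Rightarrow> real) f. (\<forall>n. meas_fun (fs n)) \<longrightarrow> meas_fun f \<longrightarrow>
        (AE x in lebesgue. (\<forall>n. 0 \<le> fs n x \<and> fs n x \<le> fs (Suc n) x) \<and> (\<lambda>n. fs n x) \<longlonglongrightarrow> f x)
        \<longrightarrow> (\<lambda>n. N (fs n)) \<longlonglongrightarrow> N f"
    using assms(1) unfolding ball_bfs_def ball_function_axioms_def by (elim conjE)
  have "\<forall>n. meas_fun (fs n)"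
    "AE x in lebesgue. (\<forall>n. 0 \<le> fs n x \<and> fs n x \<le> fs (Suc n) x) \<and> (\<lambda>n. fs n x) \<longlonglongrightarrow> f x"
    using assms(2,4-6) by simp_all
  from *[THEN spec, THEN spec, THEN mp, THEN mp, THEN mp, OF this(1) assms(3) this(2)]
  have "(\<lambda>n. N (fs n)) \<longlonglongrightarrow> N f" .
  then show ?thesis
    by (rule LIMSEQ_le_const2) (use assms(7) in blast)
qed

lemma bfs_sum_le:
  assumes "ball_bfs N" "finite I" "\<And>i. i \<in> I \<Longrightarrow> meas_fun (g i)"
  shows "N (\<lambda>x. \<Sum>i\<in>I. g i x) \<le> (\<Sum>i\<in>I. N (g i))"
  using assms(2,3)
proof (induction I)
  case empty
  then show ?case using bfs_zero[OF assms(1)] by simp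
next
  case (insert i I)
  have "N (\<lambda>x. g i x + (\<Sum>i\<in>I. g i x)) \<le> N (g i) + N (\<lambda>x. \<Sum>i\<in>I. g i x)"
    using insert.prems by (intro bfs_triangle assms(1)) (auto simp: meas_fun_def)
  also have "\<dots> \<le> N (g i) + (\<Sum>i\<in>I. N (g i))"
    using insert by (intro add_left_mono) auto
  finally show ?case using insert by simp
qed

section \<open>Integrability on bounded sets and limits almost everywhere\<close>

lemma bounded_interval_lmeasurable: "bounded_interval B \<Longrightarrow> B \<in> lmeasurable"
  by (simp add: bounded_interval_def is_interval_convex measurable_convex)

lemma integrable_bounded_support:
  fixes h :: "real \<Rightarrow> real"
  assumes "B \<in> lmeasurable" "h \<in> borel_measurable lebesgue" "\<And>x. \<bar>h x\<bar> \<le> K * indicator B x"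
  shows "integrable lebesgue h"
proof (rule Bochner_Integration.integrable_bound)
  show "integrable lebesgue (\<lambda>x. K * indicator B x)"
    using assms(1) by (intro integrable_mult_right integrable_real_indicator)
      (simp_all add: fmeasurable_def del: emeasure_completion)
  show "AE x in lebesgue. norm (h x) \<le> norm (K * indicator B x)"
    unfolding real_norm_def by (intro AE_I2 order_trans[OF assms(3) abs_ge_self])
qed (fact assms(2))

text \<open>The sum of the absolute increments has finite integral, hence is finite almost
  everywhere. At such a point the increments are absolutely summable, and telescoping turns this
  into convergence.\<close>

lemma AE_convergent_of_summable_increments:
  fixes u :: "nat \<Rightarrow> 'a \<Rightarrow> real"
  assumes "\<And>n. integrable M (u n)"
    and "summable (\<lambda>n. \<integral>x. \<bar>u (Suc n) x - u n x\<bar> \<partial>M)"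
  shows "AE x in M. convergent (\<lambda>n. u n x)"
proof -
  have [measurable]: "u n \<in> borel_measurable M" for n
    using assms(1)[of n] by simp
  have "(\<integral>\<^sup>+x. (\<Sum>n. ennreal \<bar>u (Suc n) x - u n x\<bar>) \<partial>M)
      = (\<Sum>n. \<integral>\<^sup>+x. ennreal \<bar>u (Suc n) x - u n x\<bar> \<partial>M)"
    by (rule nn_integral_suminf) measurable
  also have "\<dots> = (\<Sum>n. ennreal (\<integral>x. \<bar>u (Suc n) x - u n x\<bar> \<partial>M))"
    using assms(1) by (subst nn_integral_eq_integral) auto
  also have "\<dots> = ennreal (\<Sum>n. \<integral>x. \<bar>u (Suc n) x - u n x\<bar> \<partial>M)"
    using assms(2) by (intro suminf_ennreal2) auto
  finally have "(\<integral>\<^sup>+x. (\<Sum>n. ennreal \<bar>u (Suc n) x - u n x\<bar>) \<partial>M) \<noteq> \<infinity>"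
    by simp
  then have "AE x in M. (\<Sum>n. ennreal \<bar>u (Suc n) x - u n x\<bar>) \<noteq> \<infinity>"
    by (intro nn_integral_PInf_AE) auto
  then show ?thesis
  proof eventually_elim
    case (elim x)
    then have "summable (\<lambda>n. \<bar>u (Suc n) x - u n x\<bar>)"
      by (intro summable_suminf_not_top) auto
    then have "summable (\<lambda>n. u (Suc n) x - u n x)"
      by (rule summable_rabs_cancel)
    then have "convergent (\<lambda>n. \<Sum>k<n. u (Suc k) x - u k x)"
      by (simp add: summable_iff_convergent)
    then have "convergent (\<lambda>n. u n x - u 0 x)"
      by (simp only: sum_lessThan_telescope[of "\<lambda>k. u k x"])
    then show ?case
      by (simp only: convergent_diff_const_right_iff)
  qed
qed

text \<open>The infima over the tails increase to the liminf and each lies below some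
  \<open>u n\<close>, so the Fatou property carries the norm bound over. The uniform bound
  \<open>K\<close> keeps the liminf finite, so \<open>enn2real\<close> loses nothing.\<close>

lemma bfs_liminf_le:
  assumes "ball_bfs N" "\<And>n. meas_fun (u n)" "\<And>n x. 0 \<le> u n x" "\<And>n x. u n x \<le> K"
    and "\<And>n. N (u n) \<le> T"
  shows "N (\<lambda>x. enn2real (liminf (\<lambda>n. ennreal (u n x)))) \<le> T"
proof -
  have [measurable]: "u n \<in> borel_measurable lebesgue" for n
    using assms(2) by (rule meas_funD)
  define w where "w n x = enn2real (INF k\<in>{n..}. ennreal (u k x))" for n x
  have le: "(INF k\<in>{n..}. ennreal (u k x)) \<le> ennreal (u n x)" for n x
    by (rule INF_lower) auto
  have fin: "(INF k\<in>{n..}. ennreal (u k x)) \<le> ennreal K" for n x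
    using le[where n=n and x=x] assms(4)[of n x] by (meson ennreal_leI order_trans)
  have fin': "(INF k\<in>{n..}. ennreal (u k x)) < top" for n x
    using fin[where n=n and x=x] by (rule le_less_trans) simp
  have Lfin: "liminf (\<lambda>n. ennreal (u n x)) < top" for x
  proof -
    have "liminf (\<lambda>n. ennreal (u n x)) \<le> ennreal K"
      unfolding liminf_SUP_INF using fin by (rule SUP_least)
    then show ?thesis by (rule le_less_trans) simp
  qed
  show ?thesis
  proof (rule bfs_Fatou_mono[OF assms(1), where fs = w])
    show "meas_fun (w n)" for n
      unfolding w_def meas_fun_def by measurable
    show "meas_fun (\<lambda>x. enn2real (liminf (\<lambda>n. ennreal (u n x))))"
      unfolding meas_fun_def by measurable
    show "0 \<le> w n x" for n x by (simp add: w_def)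
    show "w n x \<le> w (Suc n) x" for n x
      unfolding w_def using fin' by (intro enn2real_mono INF_superset_mono) auto
    show "(\<lambda>n. w n x) \<longlonglongrightarrow> enn2real (liminf (\<lambda>n. ennreal (u n x)))" for x
    proof -
      have "(\<lambda>n. INF k\<in>{n..}. ennreal (u k x)) \<longlonglongrightarrow> liminf (\<lambda>n. ennreal (u n x))"
        unfolding liminf_SUP_INF
        by (rule LIMSEQ_SUP) (auto intro!: incseq_SucI INF_superset_mono)
      then show ?thesis
        unfolding w_def using Lfin[of x] by (intro tendsto_enn2real) auto
    qed
    show "N (w n) \<le> T" for n
    proof -
      have "N (w n) \<le> N (u n)"
      proof (rule bfs_mono[OF assms(1,2)])
        show "meas_fun (w n)" unfolding w_def meas_fun_def by measurable
        fix x show "\<bar>w n x\<bar> \<le> \<bar>u n x\<bar>"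
          using enn2real_mono[OF le[where n=n and x=x]] assms(3)[of n x] by (simp add: w_def)
      qed
      with assms(5)[of n] show ?thesis by simp
    qed
  qed
qed

section \<open>Separating the indicator of an interval from a ball\<close>

text \<open>This is the parallelogram law for \<open>b - u\<close> and \<open>b - v\<close>. It
  bounds the distance of two near-minimizers by how little their midpoint can improve on
  them.\<close>

lemma integral_parallelogram:
  fixes u v b :: "'a \<Rightarrow> real"
  assumes "integrable M (\<lambda>x. (b x - u x)\<^sup>2)" "integrable M (\<lambda>x. (b x - v x)\<^sup>2)"
    and "integrable M (\<lambda>x. (u x - v x)\<^sup>2)"
  shows "(\<integral>x. (u x - v x)\<^sup>2 \<partial>M)
    = 2 * (\<integral>x. (b x - u x)\<^sup>2 \<partial>M) + 2 * (\<integral>x. (b x - v x)\<^sup>2 \<partial>M)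
      - 4 * (\<integral>x. (b x - (u x + v x) / 2)\<^sup>2 \<partial>M)"
proof -
  have eq: "(b x - (u x + v x) / 2)\<^sup>2
      = (1/2) * (b x - u x)\<^sup>2 + (1/2) * (b x - v x)\<^sup>2 - (1/4) * (u x - v x)\<^sup>2" for x
    by (simp add: power2_eq_square field_simps)
  show ?thesis
    unfolding eq using assms by simp
qed

text \<open>The functions between 0 and the indicator with norm at most \<open>t\<close> form a
  convex set \<open>V\<close>. A minimizing sequence for the squared distance \<open>D\<close> is
  made to converge almost everywhere; the limit stays in \<open>V\<close> by the Fatou property and
  attains the infimum by dominated convergence.\<close>

lemma projection_onto_ball:
  assumes N: "ball_bfs N" and B: "bounded_interval B"
  obtains u0 where "meas_fun u0" "\<And>x. 0 \<le> u0 x" "\<And>x. u0 x \<le> indicator B x" "N u0 \<le> ennreal t"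
    "\<And>v. meas_fun v \<Longrightarrow> (\<And>x. 0 \<le> v x) \<Longrightarrow> (\<And>x. v x \<le> indicator B x) \<Longrightarrow> N v \<le> ennreal t \<Longrightarrow>
      (\<integral>x. (indicator B x - u0 x)\<^sup>2 \<partial>lebesgue) \<le> (\<integral>x. (indicator B x - v x)\<^sup>2 \<partial>lebesgue)"
proof -
  define b :: "real \<Rightarrow> real" where "b = indicator B"
  have BL: "B \<in> lmeasurable" using B by (rule bounded_interval_lmeasurable)
  have [measurable]: "b \<in> borel_measurable lebesgue"
    unfolding b_def using BL by (simp add: borel_measurable_indicator fmeasurableD)
  define V where "V = {v. v \<in> borel_measurable lebesgue \<and> (\<forall>x. 0 \<le> v x) \<and> (\<forall>x. v x \<le> b x) \<and> N v \<le> ennreal t}"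
  define D where "D v = (\<integral>x. (b x - v x)\<^sup>2 \<partial>lebesgue)" for v
  have Vmeas: "v \<in> borel_measurable lebesgue" if "v \<in> V" for v using that by (simp add: V_def)
  have b01: "0 \<le> b x" "b x \<le> 1" for x by (simp_all add: b_def indicator_def)
  have V01: "0 \<le> v x" "v x \<le> b x" "v x \<le> 1" if "v \<in> V" for v x
    using that b01[of x] by (auto simp: V_def intro: order_trans)
  have int: "integrable lebesgue (\<lambda>x. (v x - w x)\<^sup>2)" "integrable lebesgue (\<lambda>x. \<bar>v x - w x\<bar>)"
    if "v \<in> insert b V" "w \<in> insert b V" for v w
  proof -
    have [measurable]: "v \<in> borel_measurable lebesgue" "w \<in> borel_measurable lebesgue"
      using that Vmeas by auto
    have le: "\<bar>v x - w x\<bar> \<le> 1 * indicator B x" for x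
      using V01[of v x] V01[of w x] that by (auto simp: b_def indicator_def split: if_splits)
    have "\<bar>(v x - w x)\<^sup>2\<bar> \<le> 1 * indicator B x" for x
      using le[of x] by (auto simp: indicator_def abs_square_le_1 split: if_splits)
    then show "integrable lebesgue (\<lambda>x. (v x - w x)\<^sup>2)"
      by (rule integrable_bounded_support[OF BL, rotated]) measurable
    have "\<bar>\<bar>v x - w x\<bar>\<bar> \<le> 1 * indicator B x" for x using le[of x] by simp
    then show "integrable lebesgue (\<lambda>x. \<bar>v x - w x\<bar>)"
      by (rule integrable_bounded_support[OF BL, rotated]) measurable
  qed
  have V_int: "integrable lebesgue v" if "v \<in> V" for v
    using V01[OF that] Vmeas[OF that]
    by (intro integrable_bounded_support[OF BL, of v 1]) (auto simp: b_def)
  have D_nonneg: "0 \<le> D v" for v by (simp add: D_def)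
  have bdd: "bdd_below (D ` V)" by (rule bdd_belowI[of _ 0]) (auto simp: D_nonneg)
  have "(\<lambda>x. 0) \<in> V" using bfs_zero[OF N] by (simp add: V_def b_def)
  then have ne: "D ` V \<noteq> {}" by blast
  define d where "d = Inf (D ` V)"
  have d_le: "d \<le> D v" if "v \<in> V" for v
    unfolding d_def using bdd that by (intro cINF_lower) auto
  \<comment> \<open>The gap \<open>(1/4) ^ n\<close> gives squared \<open>L2\<close> increments of
    order \<open>4 ^ (-n)\<close>, hence summable \<open>L1\<close> increments of order
    \<open>2 ^ (-n)\<close>.\<close>
  have "\<exists>u. u \<in> V \<and> D u < d + (1/4) ^ n" for n :: nat
  proof -
    have "Inf (D ` V) < d + (1/4) ^ n" by (simp add: d_def)
    then show ?thesis using cInf_lessD[OF ne] by blast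
  qed
  then obtain u where uV: "\<And>n. u n \<in> V" and uD: "\<And>n. D (u n) < d + (1/4) ^ n" by metis
  have [measurable]: "u n \<in> borel_measurable lebesgue" for n using Vmeas[OF uV] .
  have mid: "(\<lambda>x. (v x + w x) / 2) \<in> V" if "v \<in> V" "w \<in> V" for v w
  proof -
    have m: "v \<in> borel_measurable lebesgue" "w \<in> borel_measurable lebesgue"
      using that Vmeas by auto
    have "N (\<lambda>x. v x + w x) \<le> ennreal t + ennreal t"
      using bfs_triangle[OF N, of v w] m that
      by (auto simp: meas_fun_def V_def intro: order_trans[OF _ add_mono])
    moreover have "N (\<lambda>x. (1/2) * (v x + w x)) = ennreal (1/2) * N (\<lambda>x. v x + w x)"
      using bfs_scale[OF N, of "\<lambda>x. v x + w x" "1/2"] m by (simp add: meas_fun_def)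
    ultimately have "N (\<lambda>x. (1/2) * (v x + w x)) \<le> ennreal (1/2) * (ennreal t + ennreal t)"
      by (simp add: mult_left_mono)
    \<comment> \<open>For negative \<open>t\<close> both sides are 0, because \<open>ennreal\<close>
      truncates at 0.\<close>
    also have "\<dots> = ennreal t"
    proof (cases "0 \<le> t")
      case True
      have "ennreal (1/2 * (t + t)) = ennreal (1/2) * ennreal (t + t)"
        by (rule ennreal_mult) (use True in auto)
      also have "ennreal (t + t) = ennreal t + ennreal t" by (rule ennreal_plus[OF True True])
      finally show ?thesis by simp
    qed (simp add: ennreal_neg)
    finally have "N (\<lambda>x. (v x + w x) / 2) \<le> ennreal t" by simp
    moreover have "0 \<le> (v x + w x) / 2" "(v x + w x) / 2 \<le> b x" for x
      using V01[OF that(1), of x] V01[OF that(2), of x] by auto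
    ultimately show ?thesis using m unfolding V_def by auto
  qed
  \<comment> \<open>The midpoint lies in \<open>V\<close>, so its distance is at least
    \<open>d\<close>, and the parallelogram law leaves only the two gaps.\<close>
  have sq: "(\<integral>x. (u (Suc n) x - u n x)\<^sup>2 \<partial>lebesgue) \<le> 4 * (1/4) ^ n" for n
  proof -
    have "(\<integral>x. (u (Suc n) x - u n x)\<^sup>2 \<partial>lebesgue)
        = 2 * D (u (Suc n)) + 2 * D (u n) - 4 * D (\<lambda>x. (u (Suc n) x + u n x) / 2)"
      unfolding D_def by (rule integral_parallelogram) (use int uV in auto)
    also have "\<dots> \<le> 2 * (d + (1/4) ^ Suc n) + 2 * (d + (1/4) ^ n) - 4 * d"
      using uD[of n] uD[of "Suc n"] d_le[OF mid[OF uV uV], of "Suc n" n] by simp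
    also have "\<dots> \<le> 4 * (1/4) ^ n" by simp
    finally show ?thesis .
  qed
  have L1: "(\<integral>x. \<bar>u (Suc n) x - u n x\<bar> \<partial>lebesgue) \<le> (measure lebesgue B + 4) * (1/2) ^ n" for n
  proof -
    have bi: "integrable lebesgue b"
      unfolding b_def using BL by (simp add: fmeasurable_def del: emeasure_completion)
    have iB: "(\<integral>x. b x \<partial>lebesgue) = measure lebesgue B"
      unfolding b_def using BL by (simp add: fmeasurableD)
    \<comment> \<open>A weighted form of the Cauchy-Schwarz step: expanding the square of
      \<open>?w - (1/2) ^ n\<close>, weighted by \<open>2 ^ n\<close>, gives
      \<open>?w \<le> (1/2) ^ n + 2 ^ n * ?w^2\<close> on \<open>B\<close>. Off \<open>B\<close>
      both functions vanish.\<close>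
    have "\<bar>u (Suc n) x - u n x\<bar> \<le> (1/2) ^ n * b x + 2 ^ n * (u (Suc n) x - u n x)\<^sup>2" for x
    proof (cases "x \<in> B")
      case True
      let ?w = "\<bar>u (Suc n) x - u n x\<bar>"
      have "0 \<le> 2 ^ n * (?w - (1/2) ^ n)\<^sup>2 + ?w" by simp
      also have "\<dots> = 2 ^ n * ?w\<^sup>2 - 2 * (2 ^ n * (1/2) ^ n) * ?w + (2 ^ n * (1/2) ^ n) * (1/2) ^ n + ?w"
        by (simp add: power2_eq_square algebra_simps)
      also have "(2::real) ^ n * (1/2) ^ n = 1" by (simp add: power_mult_distrib[symmetric])
      finally show ?thesis using True by (simp add: b_def)
    next
      case False
      then have "u (Suc n) x = 0" "u n x = 0"
        using V01[OF uV, of "Suc n" x] V01[OF uV, of n x] by (auto simp: b_def)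
      then show ?thesis by (simp add: b_def False)
    qed
    then have "(\<integral>x. \<bar>u (Suc n) x - u n x\<bar> \<partial>lebesgue)
        \<le> (\<integral>x. (1/2) ^ n * b x + 2 ^ n * (u (Suc n) x - u n x)\<^sup>2 \<partial>lebesgue)"
      using int[of "u (Suc n)" "u n"] uV bi by (intro integral_mono) auto
    also have "\<dots> = (1/2) ^ n * measure lebesgue B + 2 ^ n * (\<integral>x. (u (Suc n) x - u n x)\<^sup>2 \<partial>lebesgue)"
      using int[of "u (Suc n)" "u n"] uV bi by (simp add: iB)
    also have "\<dots> \<le> (1/2) ^ n * measure lebesgue B + 2 ^ n * (4 * (1/4) ^ n)"
      by (intro add_left_mono mult_left_mono sq) auto
    also have "\<dots> = (measure lebesgue B + 4) * (1/2) ^ n"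
    proof -
      have "(2::real) ^ n * (1/4) ^ n = (1/2) ^ n" by (simp add: power_mult_distrib[symmetric])
      then show ?thesis by (simp add: algebra_simps)
    qed
    finally show ?thesis .
  qed
  have "summable (\<lambda>n. (measure lebesgue B + 4) * (1/2::real) ^ n)"
    by (intro summable_mult summable_geometric) simp
  then have "summable (\<lambda>n. \<integral>x. \<bar>u (Suc n) x - u n x\<bar> \<partial>lebesgue)"
    by (rule summable_comparison_test_ev[rotated]) (use L1 in auto)
  then have conv: "AE x in lebesgue. convergent (\<lambda>n. u n x)"
    by (intro AE_convergent_of_summable_increments V_int uV)
  \<comment> \<open>The liminf is defined and measurable everywhere, so the pointwise constraints of
    \<open>V\<close> hold at every point and not merely almost everywhere.\<close>
  define u0 where "u0 x = enn2real (liminf (\<lambda>n. ennreal (u n x)))" for x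
  have [measurable]: "u0 \<in> borel_measurable lebesgue" unfolding u0_def by measurable
  have lim: "AE x in lebesgue. (\<lambda>n. u n x) \<longlonglongrightarrow> u0 x"
    using conv
  proof eventually_elim
    case (elim x)
    then obtain l where l: "(\<lambda>n. u n x) \<longlonglongrightarrow> l" by (auto simp: convergent_def)
    have "0 \<le> l" using l V01(1)[OF uV] by (intro LIMSEQ_le_const) auto
    from l have "(\<lambda>n. ennreal (u n x)) \<longlonglongrightarrow> ennreal l" by (rule tendsto_ennrealI)
    then have "liminf (\<lambda>n. ennreal (u n x)) = ennreal l" by (intro lim_imp_Liminf) auto
    then have "u0 x = l" using \<open>0 \<le> l\<close> by (simp add: u0_def)
    with l show ?case by simp
  qed
  have u0_le: "u0 x \<le> b x" for x
  proof -
    have "liminf (\<lambda>n. ennreal (u n x)) \<le> ennreal (b x)"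
      by (intro Liminf_le always_eventually allI ennreal_leI V01(2)[OF uV]) simp
    from enn2real_mono[OF this] show ?thesis by (simp add: u0_def b_def)
  qed
  have Nu0: "N u0 \<le> ennreal t"
    unfolding u0_def
    by (rule bfs_liminf_le[OF N, where K = 1])
      (use uV V01[OF uV] in \<open>auto simp: meas_fun_def V_def\<close>)
  have u0V: "u0 \<in> V" using u0_le Nu0 by (auto simp: V_def) (simp add: u0_def)
  have "(\<lambda>n. D (u n)) \<longlonglongrightarrow> D u0"
    unfolding D_def
  proof (rule integral_dominated_convergence[where w = b])
    show "integrable lebesgue b"
      unfolding b_def using BL by (simp add: fmeasurable_def del: emeasure_completion)
    show "AE x in lebesgue. (\<lambda>n. (b x - u n x)\<^sup>2) \<longlonglongrightarrow> (b x - u0 x)\<^sup>2"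
      using lim by eventually_elim (intro tendsto_intros)
    show "AE x in lebesgue. norm ((b x - u n x)\<^sup>2) \<le> b x" for n
    proof (rule AE_I2)
      fix x show "norm ((b x - u n x)\<^sup>2) \<le> b x"
        using V01[OF uV, of n x]
        by (cases "x \<in> B") (auto simp: b_def indicator_def abs_square_le_1)
    qed
  qed measurable
  moreover have "(\<lambda>n. d + (1/4) ^ n) \<longlonglongrightarrow> d + 0"
    by (intro tendsto_intros LIMSEQ_realpow_zero) auto
  ultimately have "D u0 \<le> d"
    using uD by (intro LIMSEQ_le[of "\<lambda>n. D (u n)" "D u0" "\<lambda>n. d + (1/4) ^ n" d]) (auto intro: less_imp_le)
  show thesis
  proof (rule that)
    show "meas_fun u0" by (simp add: meas_fun_def)
    show "0 \<le> u0 x" for x by (simp add: u0_def)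
    show "u0 x \<le> indicator B x" for x using u0_le by (simp add: b_def)
    show "N u0 \<le> ennreal t" by fact
    fix v assume "meas_fun v" "\<And>x. 0 \<le> v x" "\<And>x. v x \<le> indicator B x" "N v \<le> ennreal t"
    then have "v \<in> V" by (auto simp: V_def meas_fun_def b_def)
    with \<open>D u0 \<le> d\<close> d_le have "D u0 \<le> D v" by force
    then show "(\<integral>x. (indicator B x - u0 x)\<^sup>2 \<partial>lebesgue) \<le> (\<integral>x. (indicator B x - v x)\<^sup>2 \<partial>lebesgue)"
      by (simp add: D_def b_def)
  qed
qed

text \<open>The indicator of \<open>B\<close> lies outside the closed convex ball \<open>N u \<le> t\<close>; the separating
  functional \<open>g\<close> is the difference between the indicator and its \<open>L\<^sup>2\<close> projection onto that ball.\<close>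

lemma separating_functional_indicator:
  assumes N: "ball_bfs N" and B: "bounded_interval B" and t: "ennreal t < N (indicator B)" "0 < t"
  obtains g where "meas_fun g" "\<And>x. 0 \<le> g x" "\<And>x. g x \<le> indicator B x" "integrable lebesgue g"
    "0 < (\<integral>x. g x \<partial>lebesgue)"
    "\<And>u. meas_fun u \<Longrightarrow> N u \<le> ennreal t \<Longrightarrow>
      (\<integral>\<^sup>+x. ennreal \<bar>g x * u x\<bar> \<partial>lebesgue) \<le> ennreal (\<integral>x. g x \<partial>lebesgue)"
proof -
  have BL: "B \<in> lmeasurable" using B by (rule bounded_interval_lmeasurable)
  have [measurable]: "(indicator B :: real \<Rightarrow> real) \<in> borel_measurable lebesgue"
    using BL by (simp add: borel_measurable_indicator fmeasurableD)
  obtain u0 where "meas_fun u0" and u0: "\<And>x. 0 \<le> u0 x" "\<And>x. u0 x \<le> indicator B x"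
    and Nu0: "N u0 \<le> ennreal t"
    and min: "\<And>v. meas_fun v \<Longrightarrow> (\<And>x. 0 \<le> v x) \<Longrightarrow> (\<And>x. v x \<le> indicator B x) \<Longrightarrow> N v \<le> ennreal t \<Longrightarrow>
      (\<integral>x. (indicator B x - u0 x)\<^sup>2 \<partial>lebesgue) \<le> (\<integral>x. (indicator B x - v x)\<^sup>2 \<partial>lebesgue)"
    using projection_onto_ball[OF N B] by blast
  have [measurable]: "u0 \<in> borel_measurable lebesgue" using \<open>meas_fun u0\<close> by (rule meas_funD)
  have u0_1: "u0 x \<le> 1" for x using u0(2)[of x] by (cases "x \<in> B") auto
  define g where "g x = indicator B x - u0 x" for x
  have [measurable]: "g \<in> borel_measurable lebesgue" unfolding g_def by measurable
  have g: "0 \<le> g x" "g x \<le> indicator B x" for x using u0[of x] by (auto simp: g_def)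
  have supp: "g x = 0" "u0 x = 0" if "x \<notin> B" for x
    using that u0[of x] by (auto simp: g_def)
  have int_g: "integrable lebesgue g"
    by (rule integrable_bounded_support[OF BL, of _ 1]) (use g in auto)
  \<comment> \<open>If \<open>g\<close> had integral 0, the indicator would be dominated almost
    everywhere by \<open>u0\<close>, whose norm is at most \<open>t\<close>, contrary to the choice
    of \<open>t\<close>.\<close>
  have pos: "0 < (\<integral>x. g x \<partial>lebesgue)"
  proof (rule ccontr)
    assume "\<not> ?thesis"
    moreover have "0 \<le> (\<integral>x. g x \<partial>lebesgue)"
      by (intro integral_nonneg_AE AE_I2 g(1))
    ultimately have "(\<integral>x. g x \<partial>lebesgue) = 0" by linarith
    then have "AE x in lebesgue. g x = 0"
      using integral_nonneg_eq_0_iff_AE[OF int_g] g by simp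
    then have "AE x in lebesgue. \<bar>indicator B x\<bar> \<le> \<bar>u0 x\<bar>"
      by eventually_elim (simp add: g_def)
    then have "N (indicator B) \<le> N u0"
      by (intro bfs_mono_AE[OF N]) (auto simp: meas_fun_def)
    with Nu0 t show False by simp
  qed
  text \<open>First variation of the distance along the segment from \<open>u0\<close> to \<open>u\<close>; truncating at height 1
    only decreases the distance.\<close>
  have var: "(\<integral>x. g x * u x \<partial>lebesgue) \<le> (\<integral>x. g x \<partial>lebesgue)"
    if u: "meas_fun u" "\<And>x. 0 \<le> u x" "\<And>x. u x \<le> K * indicator B x" "N u \<le> ennreal t" for u K
  proof -
    have [measurable]: "u \<in> borel_measurable lebesgue" using u(1) by (rule meas_funD)
    define K' where "K' = max K 1"
    have uK: "u x \<le> K'" "u0 x \<le> K'" "g x \<le> K'" "1 \<le> K'" for x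
      using u(3)[of x] u0_1[of x] u0(1)[of x] unfolding K'_def g_def
      by (cases "x \<in> B"; simp add: le_max_iff_disj)+
    have us: "u x = 0" if "x \<notin> B" for x
      using that u(2,3)[of x] by simp
    have i1: "integrable lebesgue (\<lambda>x. g x * (u x - u0 x))"
    proof (rule integrable_bounded_support[OF BL])
      fix x show "\<bar>g x * (u x - u0 x)\<bar> \<le> K' * indicator B x"
      proof (cases "x \<in> B")
        case True
        then have "\<bar>g x\<bar> * \<bar>u x - u0 x\<bar> \<le> 1 * K'"
          using g[of x] uK(1)[of x] uK(2)[of x] u0(1)[of x] u(2)[of x]
          by (intro mult_mono) auto
        with True show ?thesis by (simp add: abs_mult)
      qed (simp add: supp)
    qed measurable
    have i2: "integrable lebesgue (\<lambda>x. (u x - u0 x)\<^sup>2)"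
    proof (rule integrable_bounded_support[OF BL])
      fix x show "\<bar>(u x - u0 x)\<^sup>2\<bar> \<le> K'\<^sup>2 * indicator B x"
      proof (cases "x \<in> B")
        case True
        have "\<bar>u x - u0 x\<bar>\<^sup>2 \<le> K'\<^sup>2"
          using uK(1)[of x] uK(2)[of x] u0(1)[of x] u(2)[of x] by (intro power_mono) auto
        with True show ?thesis by simp
      qed (simp add: supp us)
    qed measurable
    have i3: "integrable lebesgue (\<lambda>x. (g x)\<^sup>2)"
    proof (rule integrable_bounded_support[OF BL])
      fix x show "\<bar>(g x)\<^sup>2\<bar> \<le> 1 * indicator B x"
        using g[of x] by (cases "x \<in> B") (auto simp: abs_square_le_1)
    qed measurable
    define J where "J = (\<integral>x. g x * (u x - u0 x) \<partial>lebesgue)"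
    define Q where "Q = (\<integral>x. (u x - u0 x)\<^sup>2 \<partial>lebesgue)"
    \<comment> \<open>Minimality of \<open>u0\<close> is tested against a point at parameter
      \<open>s\<close> of the segment. Expanding the square, the terms of order 0 cancel and a
      factor \<open>s\<close> can be divided out.\<close>
    have J_le: "2 * J \<le> s * Q" if s: "0 < s" "s < 1" for s
    proof -
      define v where "v x = (1 - s) * u0 x + s * u x" for x
      define w where "w x = min (v x) (indicator B x)" for x
      have [measurable]: "v \<in> borel_measurable lebesgue" unfolding v_def by measurable
      have [measurable]: "w \<in> borel_measurable lebesgue" unfolding w_def by measurable
      have v0: "0 \<le> v x" for x using s u0(1) u(2) by (simp add: v_def)
      have "N v \<le> N (\<lambda>x. (1 - s) * u0 x) + N (\<lambda>x. s * u x)"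
        unfolding v_def by (intro bfs_triangle[OF N]) (auto simp: meas_fun_def)
      also have "\<dots> = ennreal (1 - s) * N u0 + ennreal s * N u"
        using s by (simp add: bfs_scale[OF N] \<open>meas_fun u0\<close> u(1))
      also have "\<dots> \<le> ennreal (1 - s) * ennreal t + ennreal s * ennreal t"
        by (intro add_mono mult_left_mono Nu0 u(4)) auto
      also have "\<dots> = ennreal ((1 - s) * t + s * t)"
        using s t(2) by (simp add: ennreal_mult ennreal_plus)
      also have "(1 - s) * t + s * t = t" by (simp add: algebra_simps)
      finally have Nv: "N v \<le> ennreal t" .
      have "N w \<le> N v"
        by (rule bfs_mono[OF N]) (use v0 in \<open>auto simp: meas_fun_def w_def\<close>)
      with Nv have Nw: "N w \<le> ennreal t" by simp
      have "0 \<le> w x" "w x \<le> indicator B x" for x using v0[of x] by (auto simp: w_def)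
      with Nw have "(\<integral>x. (g x)\<^sup>2 \<partial>lebesgue) \<le> (\<integral>x. (indicator B x - w x)\<^sup>2 \<partial>lebesgue)"
        unfolding g_def by (intro min) (auto simp: meas_fun_def)
      also have "\<dots> \<le> (\<integral>x. (g x)\<^sup>2 - 2 * s * (g x * (u x - u0 x)) + s\<^sup>2 * (u x - u0 x)\<^sup>2 \<partial>lebesgue)"
      proof (rule integral_mono)
        show "integrable lebesgue (\<lambda>x. (indicator B x - w x)\<^sup>2)"
        proof (rule integrable_bounded_support[OF BL])
          fix x show "\<bar>(indicator B x - w x)\<^sup>2\<bar> \<le> 1 * indicator B x"
            using v0[of x] by (cases "x \<in> B") (auto simp: abs_square_le_1 w_def)
        qed measurable
        show "integrable lebesgue
            (\<lambda>x. (g x)\<^sup>2 - 2 * s * (g x * (u x - u0 x)) + s\<^sup>2 * (u x - u0 x)\<^sup>2)"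
          using i1 i2 i3 by auto
        fix x
        have "(indicator B x - w x)\<^sup>2 \<le> (indicator B x - v x)\<^sup>2"
          unfolding w_def by (cases "v x \<le> indicator B x") auto
        also have "\<dots> = (g x)\<^sup>2 - 2 * s * (g x * (u x - u0 x)) + s\<^sup>2 * (u x - u0 x)\<^sup>2"
          by (simp add: g_def v_def power2_eq_square algebra_simps)
        finally show "(indicator B x - w x)\<^sup>2
            \<le> (g x)\<^sup>2 - 2 * s * (g x * (u x - u0 x)) + s\<^sup>2 * (u x - u0 x)\<^sup>2" .
      qed
      also have "\<dots> = (\<integral>x. (g x)\<^sup>2 \<partial>lebesgue) - 2 * s * J + s\<^sup>2 * Q"
        using i1 i2 i3 by (simp add: J_def Q_def)
      finally have "s * (2 * J) \<le> s * (s * Q)" by (simp add: power2_eq_square)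
      with s show ?thesis by simp
    qed
    \<comment> \<open>Letting \<open>s\<close> tend to 0 removes the quadratic term.\<close>
    have "J \<le> 0"
    proof -
      have "((\<lambda>s. s * Q) \<longlongrightarrow> 0 * Q) (at_right 0)" by (intro tendsto_intros)
      moreover have "\<forall>\<^sub>F s in at_right (0::real). 2 * J \<le> s * Q"
        using eventually_at_right_real[of 0 1] by (rule eventually_mono) (use J_le in auto)
      ultimately have "2 * J \<le> 0 * Q"
        by (intro tendsto_lowerbound) auto
      then show ?thesis by simp
    qed
    have i4: "integrable lebesgue (\<lambda>x. g x * u0 x)"
    proof (rule integrable_bounded_support[OF BL])
      fix x show "\<bar>g x * u0 x\<bar> \<le> 1 * indicator B x"
        using g[of x] u0[of x] u0_1[of x]
        by (cases "x \<in> B") (auto simp: abs_mult intro!: mult_le_one)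
    qed measurable
    \<comment> \<open>The sign of \<open>J\<close> says that \<open>g\<close> is largest on the ball
      at \<open>u0\<close>, and \<open>u0 \<le> 1\<close> bounds that value by the integral of
      \<open>g\<close>.\<close>
    have "(\<integral>x. g x * u x \<partial>lebesgue) = (\<integral>x. g x * (u x - u0 x) + g x * u0 x \<partial>lebesgue)"
      by (simp add: algebra_simps)
    also have "\<dots> = J + (\<integral>x. g x * u0 x \<partial>lebesgue)"
      using i1 i4 by (simp add: J_def)
    also have "\<dots> \<le> (\<integral>x. g x * u0 x \<partial>lebesgue)" using \<open>J \<le> 0\<close> by simp
    also have "\<dots> \<le> (\<integral>x. g x \<partial>lebesgue)"
      using i4 int_g g(1) u0_1 by (intro integral_mono) (auto intro: mult_left_le)
    finally show ?thesis .
  qed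
  show thesis
  proof (rule that)
    show "meas_fun g" by (simp add: meas_fun_def)
    fix u assume u: "meas_fun u" "N u \<le> ennreal t"
    then have [measurable]: "u \<in> borel_measurable lebesgue" by (simp add: meas_fun_def)
    \<comment> \<open>Truncation at height \<open>n\<close> and restriction to \<open>B\<close>
      bring \<open>u\<close> into the scope of \<open>var\<close> with \<open>K = n\<close>.
      Monotone convergence then recovers \<open>\<bar>u\<bar>\<close> on \<open>B\<close>, outside
      of which \<open>g\<close> vanishes.\<close>
    define w where "w n x = min \<bar>u x\<bar> (real n) * indicator B x" for n x
    have [measurable]: "w n \<in> borel_measurable lebesgue" for n unfolding w_def by measurable
    have sup: "ennreal \<bar>g x * u x\<bar> = (SUP n. ennreal (g x * w n x))" for x
    proof -
      have "incseq (\<lambda>n. ennreal (g x * w n x))"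
        using g(1)[of x] unfolding w_def
        by (intro incseq_SucI ennreal_leI mult_left_mono mult_right_mono) auto
      moreover have "(\<lambda>n. ennreal (g x * w n x)) \<longlonglongrightarrow> ennreal \<bar>g x * u x\<bar>"
      proof (rule tendsto_eventually)
        obtain n0 :: nat where "\<bar>u x\<bar> \<le> real n0" using real_arch_simple by blast
        then have "w n x = \<bar>u x\<bar> * indicator B x" if "n \<ge> n0" for n
          using that by (auto simp: w_def min_def)
        then show "\<forall>\<^sub>F n in sequentially. ennreal (g x * w n x) = ennreal \<bar>g x * u x\<bar>"
          using g(1)[of x] supp(1)[of x] unfolding eventually_sequentially
          by (intro exI[of _ n0]) (cases "x \<in> B"; simp add: abs_mult)
      qed
      ultimately show ?thesis
        using LIMSEQ_unique LIMSEQ_SUP by blast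
    qed
    have "(\<integral>\<^sup>+x. ennreal \<bar>g x * u x\<bar> \<partial>lebesgue) = (SUP n. \<integral>\<^sup>+x. ennreal (g x * w n x) \<partial>lebesgue)"
      unfolding sup
    proof (rule nn_integral_monotone_convergence_SUP)
      show "incseq (\<lambda>n x. ennreal (g x * w n x))"
        using g(1) unfolding w_def incseq_Suc_iff le_fun_def
        by (intro allI ennreal_leI mult_left_mono mult_right_mono) auto
    qed measurable
    also have "\<dots> \<le> ennreal (\<integral>x. g x \<partial>lebesgue)"
    proof (rule SUP_least)
      fix n
      have "integrable lebesgue (\<lambda>x. g x * w n x)"
      proof (rule integrable_bounded_support[OF BL])
        fix x
        have "g x * w n x \<le> 1 * (real n * indicator B x)"
          using g[of x] by (intro mult_mono) (cases "x \<in> B"; simp add: w_def)+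
        then show "\<bar>g x * w n x\<bar> \<le> real n * indicator B x"
          using g(1)[of x] by (simp add: w_def)
      qed measurable
      then have "(\<integral>\<^sup>+x. ennreal (g x * w n x) \<partial>lebesgue) = ennreal (\<integral>x. g x * w n x \<partial>lebesgue)"
        using g(1) by (intro nn_integral_eq_integral) (auto simp: w_def)
      also have "\<dots> \<le> ennreal (\<integral>x. g x \<partial>lebesgue)"
      proof (intro ennreal_leI var[where K = "real n"])
        show "meas_fun (w n)" by (simp add: meas_fun_def)
        have "N (w n) \<le> N u"
          using u(1) by (intro bfs_mono[OF N])
            (auto simp: meas_fun_def w_def indicator_def)
        with u(2) show "N (w n) \<le> ennreal t" by simp
      qed (auto simp: w_def intro: mult_right_mono)
      finally show "(\<integral>\<^sup>+x. ennreal (g x * w n x) \<partial>lebesgue) \<le> ennreal (\<integral>x. g x \<partial>lebesgue)" .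
    qed
    finally show "(\<integral>\<^sup>+x. ennreal \<bar>g x * u x\<bar> \<partial>lebesgue) \<le> ennreal (\<integral>x. g x \<partial>lebesgue)" .
  qed (use g int_g pos in auto)
qed

section \<open>Consequences of the maximal operator bound\<close>

lemma meas_fun_indicator: "bounded_interval B \<Longrightarrow> meas_fun (indicator B)"
  unfolding meas_fun_def
  by (rule borel_measurable_indicator) (rule fmeasurableD[OF bounded_interval_lmeasurable])

lemma bounded_interval_greaterThanLessThan: "bounded_interval {a<..<b}"
  by (simp add: bounded_interval_def is_interval_convex convex_real_interval)

text \<open>Too large a norm of the indicator yields a function \<open>g\<close> whose associate
  norm is small relative to its integral \<open>G\<close>. On \<open>(-1, 1)\<close> the maximal
  function of \<open>g\<close> is at least \<open>G / (2 * r)\<close>, and pairing it with a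
  normalized indicator contradicts the maximal inequality.\<close>

lemma bfs_symmetric_interval_linear_bound:
  assumes Y: "ball_bfs Y" and M: "maximal_bounded_on (assoc_norm Y)"
  obtains C :: real where "0 < C" "\<And>r. 1 \<le> r \<Longrightarrow> Y (indicator {-r<..<r}) \<le> ennreal (C * r)"
proof -
  obtain C0 :: real where C0: "\<And>f. meas_fun f \<Longrightarrow> assoc_norm Y f < \<infinity> \<Longrightarrow>
      ext_norm (assoc_norm Y) (hl_max f) \<le> ennreal C0 * assoc_norm Y f"
    using M unfolding maximal_bounded_on_def by blast
  define I :: "real set" where "I = {-1<..<1}"
  note bi = bounded_interval_greaterThanLessThan
  have mI: "meas_fun (indicator I)"
    unfolding I_def by (rule meas_fun_indicator[OF bi])
  have "Y (indicator I) < \<infinity>" using bfs_indicator_finite[OF Y bi[of "-1" 1]] by (simp add: I_def)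
  \<comment> \<open>Norm 0 would make the indicator vanish almost everywhere, but \<open>I\<close>
    has measure 2.\<close>
  moreover have "Y (indicator I) \<noteq> 0"
  proof
    assume "Y (indicator I) = 0"
    from bfs_eq_0_AE[OF Y mI this] have "AE x in lebesgue. x \<notin> I"
      by eventually_elim (simp add: indicator_def split: if_splits)
    then have "emeasure lebesgue I = 0"
      by (subst (asm) AE_iff_measurable[of I]) (auto simp: I_def)
    then show False by (simp add: I_def)
  qed
  ultimately obtain n1 where n1: "Y (indicator I) = ennreal n1" "0 < n1"
    by (metis enn2real_positive_iff ennreal_enn2real infinity_ennreal_def not_gr_zero)
  \<comment> \<open>The constant \<open>C0\<close> may be nonpositive; the maximum with 1 makes
    division by it safe.\<close>
  define K where "K = max C0 1"
  have K: "0 < K" "C0 \<le> K" by (auto simp: K_def)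
  show thesis
  proof (rule that[of "2 * K * n1"])
    show "0 < 2 * K * n1" using K n1 by simp
    fix r :: real assume r: "1 \<le> r"
    define t where "t = 2 * K * n1 * r"
    have t: "0 < t" using K n1 r by (simp add: t_def)
    show "Y (indicator {-r<..<r}) \<le> ennreal (2 * K * n1 * r)"
    proof (rule ccontr)
      assume "\<not> ?thesis"
      then have gt: "ennreal t < Y (indicator {-r<..<r})" by (simp add: t_def)
      obtain g where g: "meas_fun g" "\<And>x. 0 \<le> g x" "\<And>x. g x \<le> indicator {-r<..<r} x"
          "integrable lebesgue g" "0 < (\<integral>x. g x \<partial>lebesgue)"
        and sep: "\<And>u. meas_fun u \<Longrightarrow> Y u \<le> ennreal t \<Longrightarrow>
          (\<integral>\<^sup>+x. ennreal \<bar>g x * u x\<bar> \<partial>lebesgue) \<le> ennreal (\<integral>x. g x \<partial>lebesgue)"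
        using separating_functional_indicator[OF Y bi gt t] by blast
      define G where "G = (\<integral>x. g x \<partial>lebesgue)"
      have [measurable]: "g \<in> borel_measurable lebesgue" using g(1) by (rule meas_funD)
      \<comment> \<open>A function \<open>u\<close> of norm 1 is scaled to \<open>t * u\<close>,
        which lies in the ball where \<open>sep\<close> applies; dividing by \<open>t\<close> gives
        the bound.\<close>
      have assoc: "assoc_norm Y g \<le> ennreal (G / t)"
        unfolding assoc_norm_def
      proof (rule SUP_least)
        fix u assume "u \<in> {u. meas_fun u \<and> Y u = 1}"
        then have u: "meas_fun u" "Y u = 1" by auto
        then have [measurable]: "u \<in> borel_measurable lebesgue" by (simp add: meas_fun_def)
        have "(\<integral>\<^sup>+x. ennreal \<bar>g x * (t * u x)\<bar> \<partial>lebesgue) \<le> ennreal G"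
          unfolding G_def using t u bfs_scale[OF Y u(1), of t]
          by (intro sep) (auto simp: meas_fun_def)
        also have "(\<integral>\<^sup>+x. ennreal \<bar>g x * (t * u x)\<bar> \<partial>lebesgue)
            = ennreal t * (\<integral>\<^sup>+x. ennreal \<bar>g x * u x\<bar> \<partial>lebesgue)"
          using t by (subst nn_integral_cmult[symmetric])
            (auto simp: abs_mult ennreal_mult[symmetric] mult.left_commute intro!: nn_integral_cong)
        finally have le: "ennreal t * (\<integral>\<^sup>+x. ennreal \<bar>g x * u x\<bar> \<partial>lebesgue) \<le> ennreal G" .
        have "(\<integral>\<^sup>+x. ennreal \<bar>g x * u x\<bar> \<partial>lebesgue)
            = ennreal (1 / t) * (ennreal t * (\<integral>\<^sup>+x. ennreal \<bar>g x * u x\<bar> \<partial>lebesgue))"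
          using t by (simp add: mult.assoc[symmetric] ennreal_mult[symmetric])
        also have "\<dots> \<le> ennreal (1 / t) * ennreal G" by (intro mult_left_mono le) simp
        also have "\<dots> = ennreal (G / t)" using t g(5) by (simp add: ennreal_mult[symmetric] G_def)
        finally show "(\<integral>\<^sup>+x. ennreal \<bar>g x * u x\<bar> \<partial>lebesgue) \<le> ennreal (G / t)" .
      qed
      then have "assoc_norm Y g < \<infinity>" by (rule le_less_trans) simp
      from C0[OF g(1) this] have "ext_norm (assoc_norm Y) (hl_max g) \<le> ennreal C0 * assoc_norm Y g" .
      also have "\<dots> \<le> ennreal K * ennreal (G / t)"
        by (intro mult_mono assoc ennreal_leI K) auto
      also have "\<dots> = ennreal (G / (2 * n1 * r))"
        using K t g(5) by (simp add: ennreal_mult[symmetric] t_def G_def mult.assoc)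
      finally have ext: "ext_norm (assoc_norm Y) (hl_max g) \<le> ennreal (G / (2 * n1 * r))" .
      then have fin: "AE x in lebesgue. hl_max g x < \<infinity>"
        unfolding ext_norm_def by (auto split: if_splits simp: top_unique)
      define h where "h x = enn2real (hl_max g x)" for x
      \<comment> \<open>This is the test function in the supremum defining the associate norm of
        \<open>h\<close>, normalized so that \<open>Y u = 1\<close>.\<close>
      define u where "u x = (1 / n1) * indicator I x" for x
      have u: "meas_fun u" "Y u = 1"
      proof -
        show "meas_fun u" using mI unfolding u_def meas_fun_def by measurable
        show "Y u = 1"
          unfolding u_def using bfs_scale[OF Y mI, of "1 / n1"] n1 by (simp add: ennreal_mult[symmetric])
      qed
      \<comment> \<open>As \<open>1 \<le> r\<close>, the interval \<open>(-r, r)\<close> contains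
        every point of \<open>I\<close> and so is admissible in \<open>hl_max\<close>. It also
        carries all the mass of \<open>g\<close>.\<close>
      have hl: "ennreal (G / (2 * r)) \<le> hl_max g x" if "x \<in> I" for x
      proof -
        have "(\<integral>\<^sup>+y\<in>{-r<..<r}. ennreal \<bar>g y\<bar> \<partial>lebesgue) = (\<integral>\<^sup>+y. ennreal (g y) \<partial>lebesgue)"
          using g(2,3) by (intro nn_integral_cong) 
            (metis abs_of_nonneg antisym ennreal_0 indicator_simps mult.right_neutral mult_zero_left)
        also have "\<dots> = ennreal G"
          unfolding G_def using g(2,4) by (intro nn_integral_eq_integral) auto
        finally have "(\<integral>\<^sup>+y\<in>{-r<..<r}. ennreal \<bar>g y\<bar> \<partial>lebesgue) / ennreal (r - (-r)) = ennreal (G / (2 * r))"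
          using r g(5) by (simp add: divide_ennreal G_def)
        moreover have "(\<integral>\<^sup>+y\<in>{-r<..<r}. ennreal \<bar>g y\<bar> \<partial>lebesgue) / ennreal (r - (-r)) \<le> hl_max g x"
          unfolding hl_max_def using that r
          by (intro SUP_upper2[of "(-r, r)"]) (auto simp: I_def)
        ultimately show ?thesis by simp
      qed
      have "ennreal (G / (n1 * r)) = ennreal (G / (2 * r) * (1 / n1)) * emeasure lebesgue I"
        using r n1 g(5) by (simp add: I_def G_def ennreal_mult[symmetric] ennreal_numeral[symmetric] del: ennreal_numeral)
      also have "\<dots> = (\<integral>\<^sup>+x. ennreal (G / (2 * r) * (1 / n1)) * indicator I x \<partial>lebesgue)"
        by (subst nn_integral_cmult_indicator) (auto simp: I_def)
      also have "\<dots> \<le> (\<integral>\<^sup>+x. ennreal \<bar>h x * u x\<bar> \<partial>lebesgue)"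
      proof (rule nn_integral_mono_AE)
        show "AE x in lebesgue. ennreal (G / (2 * r) * (1 / n1)) * indicator I x \<le> ennreal \<bar>h x * u x\<bar>"
          using fin
        proof eventually_elim
          case (elim x)
          show ?case
          proof (cases "x \<in> I")
            case True
            have "G / (2 * r) \<le> h x"
              using enn2real_mono[OF hl[OF True]] elim r g(5) by (simp add: h_def G_def)
            then have "G / (2 * r) * (1 / n1) \<le> h x * (1 / n1)"
              using n1 by (intro mult_right_mono) auto
            also have "\<dots> \<le> \<bar>h x * u x\<bar>" using True n1 by (simp add: u_def abs_mult divide_right_mono)
            finally show ?thesis using True by (simp add: ennreal_leI)
          qed simp
        qed
      qed
      also have "\<dots> \<le> assoc_norm Y h"
        unfolding assoc_norm_def using u by (intro SUP_upper) auto
      also have "\<dots> \<le> ennreal (G / (2 * n1 * r))"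
        using ext fin unfolding ext_norm_def h_def by simp
      \<comment> \<open>The factor 2 in \<open>t\<close> makes the upper bound exactly half of the
        lower one, which is impossible since \<open>G\<close> is positive.\<close>
      finally have "G / (n1 * r) \<le> G / (2 * n1 * r)"
        using n1 r g(5) by (subst (asm) ennreal_le_iff) (auto simp: G_def)
      moreover have "G / (n1 * r) = 2 * (G / (2 * n1 * r))" by simp
      moreover have "0 < G / (2 * n1 * r)" using n1 r g(5) by (simp add: G_def)
      ultimately show False by linarith
    qed
  qed
qed

text \<open>Where \<open>2 ^ k \<le> \<bar>x\<bar> < 2 ^ (k + 1)\<close>, the power is at most
  \<open>a ^ k\<close> with \<open>a = 2 powr (-s)\<close>, so the tail lies below the series
  \<open>H\<close>. By the linear bound its term \<open>k\<close> has norm at most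
  \<open>2 * C * (2 * a) ^ k\<close>, and \<open>2 * a < 1\<close> because \<open>s > 1\<close>. The
  Fatou property passes from partial sums to \<open>H\<close>.\<close>

lemma bfs_power_decay_finite:
  fixes s C :: real
  assumes Y: "ball_bfs Y" and s: "1 < s" and C: "0 < C"
    and bound: "\<And>r. 1 \<le> r \<Longrightarrow> Y (indicator {-r<..<r}) \<le> ennreal (C * r)"
  shows "Y (\<lambda>x. if 1 < \<bar>x\<bar> then \<bar>x\<bar> powr (-s) else 0) < \<infinity>"
proof -
  define a :: real where "a = 2 powr (-s)"
  define A :: "nat \<Rightarrow> real set" where "A k = {-(2 ^ Suc k)<..<2 ^ Suc k}" for k
  have "(2::real) powr (-s) < 2 powr (-1)" using s by (intro powr_less_mono) auto
  then have a: "0 < a" "2 * a < 1" by (simp_all add: a_def powr_minus_divide)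
  define h where "h m x = (\<Sum>k<m. a ^ k * indicator (A k) x)" for m x
  define H where "H x = (\<Sum>k. a ^ k * indicator (A k) x)" for x
  have sm: "summable (\<lambda>k. a ^ k * indicator (A k) x)" for x
  proof (rule summable_comparison_test')
    show "summable (\<lambda>k. a ^ k)" using a by (intro summable_geometric) auto
    show "norm (a ^ k * indicator (A k) x) \<le> a ^ k" if "0 \<le> k" for k
      using a by (auto simp: indicator_def)
  qed
  have mA: "meas_fun (indicator (A k))" for k
    unfolding A_def by (rule meas_fun_indicator[OF bounded_interval_greaterThanLessThan])
  then have [measurable]: "(indicator (A k) :: real \<Rightarrow> real) \<in> borel_measurable lebesgue" for k
    by (rule meas_funD)
  have ms: "meas_fun (h m)" for m
    unfolding h_def meas_fun_def by measurable
  have msH: "meas_fun H"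
    unfolding H_def meas_fun_def by measurable
  have sm2: "summable (\<lambda>k. (2 * a) ^ k)" using a by (intro summable_geometric) auto
  have "Y H \<le> ennreal (2 * C * (\<Sum>k. (2 * a) ^ k))"
  proof (rule bfs_Fatou_mono[OF Y ms msH])
    show "0 \<le> h m x" for m x using a by (auto simp: h_def intro!: sum_nonneg)
    show "h m x \<le> h (Suc m) x" for m x using a by (simp add: h_def)
    show "(\<lambda>n. h n x) \<longlonglongrightarrow> H x" for x
      unfolding h_def H_def by (rule summable_LIMSEQ[OF sm])
    fix m
    have "Y (h m) \<le> (\<Sum>k<m. Y (\<lambda>x. a ^ k * indicator (A k) x))"
      unfolding h_def by (rule bfs_sum_le[OF Y]) (auto simp: meas_fun_def)
    also have "\<dots> \<le> (\<Sum>k<m. ennreal (2 * C * (2 * a) ^ k))"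
    proof (rule sum_mono)
      fix k
      have "Y (\<lambda>x. a ^ k * indicator (A k) x) = ennreal (a ^ k) * Y (indicator (A k))"
        using bfs_scale[OF Y mA, of "a ^ k" k] a by simp
      also have "\<dots> \<le> ennreal (a ^ k) * ennreal (C * 2 ^ Suc k)"
        unfolding A_def by (intro mult_left_mono bound) (auto simp del: power_Suc)
      also have "\<dots> = ennreal (2 * C * (2 * a) ^ k)"
        using a C by (simp add: ennreal_mult[symmetric] power_mult_distrib algebra_simps)
      finally show "Y (\<lambda>x. a ^ k * indicator (A k) x) \<le> ennreal (2 * C * (2 * a) ^ k)" .
    qed
    also have "\<dots> = ennreal (2 * C * (\<Sum>k<m. (2 * a) ^ k))"
      using a C by (subst sum_ennreal) (auto simp: sum_distrib_left)
    also have "\<dots> \<le> ennreal (2 * C * (\<Sum>k. (2 * a) ^ k))"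
      using a C by (intro ennreal_leI mult_left_mono sum_le_suminf sm2) auto
    finally show "Y (h m) \<le> ennreal (2 * C * (\<Sum>k. (2 * a) ^ k))" .
  qed
  then have "Y H < \<infinity>" by (rule le_less_trans) simp
  moreover have "Y (\<lambda>x. if 1 < \<bar>x\<bar> then \<bar>x\<bar> powr (-s) else 0) \<le> Y H"
  proof (rule bfs_mono[OF Y msH])
    show "meas_fun (\<lambda>x. if 1 < \<bar>x\<bar> then \<bar>x\<bar> powr (-s) else 0)"
      unfolding meas_fun_def by (rule measurable_completion) measurable
    fix x :: real
    have H0: "0 \<le> H x" unfolding H_def using a by (intro suminf_nonneg sm) auto
    show "\<bar>if 1 < \<bar>x\<bar> then \<bar>x\<bar> powr (-s) else 0\<bar> \<le> \<bar>H x\<bar>"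
    proof (cases "1 < \<bar>x\<bar>")
      case True
      \<comment> \<open>Since \<open>\<bar>x\<bar> > 1\<close>, this least exponent is some
        \<open>Suc k\<close>; then \<open>2 ^ k \<le> \<bar>x\<bar>\<close> and \<open>x\<close>
        lies in \<open>A k\<close>, so the single term \<open>k\<close> of the series already
        dominates.\<close>
      define n where "n = (LEAST n. \<bar>x\<bar> < 2 ^ n)"
      have n: "\<bar>x\<bar> < 2 ^ n"
        unfolding n_def using real_arch_pow[of 2 "\<bar>x\<bar>"] by (auto intro: LeastI_ex)
      with True obtain k where k: "n = Suc k" by (cases n) auto
      have "\<not> \<bar>x\<bar> < 2 ^ k" using not_less_Least[of k "\<lambda>n. \<bar>x\<bar> < 2 ^ n"] k n_def by simp
      then have "\<bar>x\<bar> powr (-s) \<le> (2 ^ k) powr (-s)"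
        using s by (intro powr_mono2') auto
      also have "\<dots> = a ^ k"
        by (simp add: a_def powr_realpow[symmetric] powr_powr mult.commute)
      also have "\<dots> = (\<Sum>j\<in>{k}. a ^ j * indicator (A j) x)"
        using n k by (simp add: A_def abs_less_iff)
      also have "\<dots> \<le> H x"
        unfolding H_def using a by (intro sum_le_suminf sm) auto
      finally show ?thesis using True H0 by simp
    qed (use H0 in simp)
  qed
  ultimately show ?thesis by (rule le_less_trans[rotated])
qed

text \<open>With \<open>s = - p * \<gamma> / q\<close>, the power \<open>-s\<close> in the
  \<open>1/p\<close>-space corresponds to the power \<open>\<gamma> / q\<close> in the original one,
  and \<open>q < - p * \<gamma>\<close> says precisely that \<open>s > 1\<close>.\<close>

lemma bfs_decay_finite:
  assumes par: "1 \<le> p" "\<gamma> < 0" "0 < q" "q < - p * \<gamma>"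
    and Y: "ball_bfs (power_norm N (1 / p))" "maximal_bounded_on (assoc_norm (power_norm N (1 / p)))"
  shows "N (\<lambda>x. if 1 < \<bar>x\<bar> then \<bar>x\<bar> powr (\<gamma> / q) else 0) < \<infinity>"
proof -
  define s where "s = - p * \<gamma> / q"
  have s: "1 < s" using par unfolding s_def by (subst less_divide_eq_1_pos) auto
  define d where "d x = (if 1 < \<bar>x\<bar> then \<bar>x\<bar> powr (-s) else 0)" for x :: real
  obtain C :: real where "0 < C"
    "\<And>r. 1 \<le> r \<Longrightarrow> power_norm N (1 / p) (indicator {-r<..<r}) \<le> ennreal (C * r)"
    using bfs_symmetric_interval_linear_bound[OF Y] by blast
  then have "power_norm N (1 / p) d < \<infinity>"
    unfolding d_def by (rule bfs_power_decay_finite[OF Y(1) s])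
  then have "N (\<lambda>x. \<bar>d x\<bar> powr (1 / p)) < \<infinity>"
    by (auto simp: power_norm_def enn_powr_def top.not_eq_extremum split: if_splits)
  moreover have "\<bar>d x\<bar> powr (1 / p) = (if 1 < \<bar>x\<bar> then \<bar>x\<bar> powr (\<gamma> / q) else 0)" for x
    using par by (simp add: d_def s_def powr_powr)
  ultimately show ?thesis by simp
qed

section \<open>Pointwise estimates\<close>

lemma nn_integral_powr_atLeast:
  fixes \<gamma> r :: real
  assumes "\<gamma> < 0" "0 < r"
  shows "(\<integral>\<^sup>+z. indicator {r..} z * ennreal (\<bar>z\<bar> powr (\<gamma> - 1)) \<partial>lborel) = ennreal (- (r powr \<gamma>) / \<gamma>)"
proof -
  have "(\<integral>\<^sup>+z. indicator {r..} z * ennreal (\<bar>z\<bar> powr (\<gamma> - 1)) \<partial>lborel)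
      = (\<integral>\<^sup>+z. ennreal (z powr (\<gamma> - 1)) * indicator {r..} z \<partial>lborel)"
    using assms by (intro nn_integral_cong) (auto simp: indicator_def)
  also have "\<dots> = ennreal (0 - r powr \<gamma> / \<gamma>)"
  proof (rule nn_integral_FTC_atLeast)
    show "((\<lambda>z. z powr \<gamma> / \<gamma>) has_real_derivative z powr (\<gamma> - 1)) (at z)" if "r \<le> z" for z
      using that assms by (auto intro!: derivative_eq_intros)
    show "((\<lambda>z. z powr \<gamma> / \<gamma>) \<longlongrightarrow> 0) at_top"
      using assms by (intro tendsto_divide_zero tendsto_neg_powr filterlim_ident) auto
  qed auto
  finally show ?thesis by simp
qed

text \<open>The half-lines on either side of \<open>x\<close> contribute equally. This is the source
  of the factor 2, the value of \<open>kappa1 q\<close>.\<close>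

lemma nn_integral_powr_outside:
  fixes \<gamma> r x :: real
  assumes "\<gamma> < 0" "0 < r"
  shows "(\<integral>\<^sup>+y. indicator {y. r \<le> \<bar>x - y\<bar>} y * ennreal (\<bar>x - y\<bar> powr (\<gamma> - 1)) \<partial>lebesgue)
    = ennreal (- 2 / \<gamma> * r powr \<gamma>)"
proof -
  define \<phi> where "\<phi> z = indicator {r..} z * ennreal (\<bar>z\<bar> powr (\<gamma> - 1))" for z
  have [measurable]: "\<phi> \<in> borel_measurable borel" unfolding \<phi>_def by measurable
  have "(\<integral>\<^sup>+y. indicator {y. r \<le> \<bar>x - y\<bar>} y * ennreal (\<bar>x - y\<bar> powr (\<gamma> - 1)) \<partial>lebesgue)
      = (\<integral>\<^sup>+y. \<phi> (x - y) + \<phi> (y - x) \<partial>lborel)"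
    unfolding nn_integral_completion using assms
    by (intro nn_integral_cong) (auto simp: \<phi>_def indicator_def abs_minus_commute)
  also have "\<dots> = (\<integral>\<^sup>+y. \<phi> (x - y) \<partial>lborel) + (\<integral>\<^sup>+y. \<phi> (y - x) \<partial>lborel)"
    by (rule nn_integral_add) measurable
  also have "(\<integral>\<^sup>+y. \<phi> (x - y) \<partial>lborel) = (\<integral>\<^sup>+z. \<phi> z \<partial>lborel)"
    using nn_integral_real_affine[of \<phi> "-1" x] by simp
  also have "(\<integral>\<^sup>+y. \<phi> (y - x) \<partial>lborel) = (\<integral>\<^sup>+z. \<phi> z \<partial>lborel)"
    using nn_integral_real_affine[of \<phi> 1 "-x"] by simp
  also have "(\<integral>\<^sup>+z. \<phi> z \<partial>lborel) = ennreal (- (r powr \<gamma>) / \<gamma>)"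
    unfolding \<phi>_def using assms by (rule nn_integral_powr_atLeast)
  also have "ennreal (- (r powr \<gamma>) / \<gamma>) + ennreal (- (r powr \<gamma>) / \<gamma>)
      = ennreal (- (r powr \<gamma>) / \<gamma> + - (r powr \<gamma>) / \<gamma>)"
    using assms by (subst ennreal_plus) (auto simp: divide_nonneg_neg divide_nonpos_neg)
  also have "- (r powr \<gamma>) / \<gamma> + - (r powr \<gamma>) / \<gamma> = - 2 / \<gamma> * r powr \<gamma>" by simp
  finally show ?thesis .
qed

section \<open>Bounds for the inner integral at a fixed point\<close>

definition level_integral :: "real \<Rightarrow> real \<Rightarrow> (real \<Rightarrow> real) \<Rightarrow> real \<Rightarrow> real \<Rightarrow> ennreal" where
  "level_integral \<gamma> q f lam x =
    (\<integral>\<^sup>+y. indicator (E_set lam (\<gamma> / q) f) (x, y) * ennreal (\<bar>x - y\<bar> powr (\<gamma> - 1)) \<partial>lebesgue)"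

lemma measurable_level_integral:
  assumes "continuous_on UNIV f"
  shows "level_integral \<gamma> q f lam \<in> borel_measurable lebesgue"
proof -
  have [measurable]: "f \<in> borel_measurable borel"
    using assms by (rule borel_measurable_continuous_onI)
  have "(\<lambda>x. \<integral>\<^sup>+y. (if x \<noteq> y \<and> \<bar>f x - f y\<bar> / \<bar>x - y\<bar> powr (1 + \<gamma> / q) > lam
      then ennreal (\<bar>x - y\<bar> powr (\<gamma> - 1)) else 0) \<partial>lborel) \<in> borel_measurable lborel"
    by measurable
  also have "(\<lambda>x. \<integral>\<^sup>+y. (if x \<noteq> y \<and> \<bar>f x - f y\<bar> / \<bar>x - y\<bar> powr (1 + \<gamma> / q) > lam
      then ennreal (\<bar>x - y\<bar> powr (\<gamma> - 1)) else 0) \<partial>lborel) = level_integral \<gamma> q f lam"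
    unfolding level_integral_def nn_integral_completion E_set_def
    by (intro ext nn_integral_cong) (auto simp: indicator_def)
  finally show ?thesis by (rule measurable_completion)
qed

text \<open>Where \<open>f y = f x\<close> the difference quotient is 0 and cannot exceed
  \<open>lam \<ge> 0\<close>, so only \<open>y\<close> at distance at least \<open>r\<close>
  contribute.\<close>

lemma level_integral_far:
  assumes "\<gamma> < 0" "0 < r" "0 \<le> lam" "\<And>y. \<bar>x - y\<bar> < r \<Longrightarrow> f y = f x"
  shows "level_integral \<gamma> q f lam x \<le> ennreal (- 2 / \<gamma> * r powr \<gamma>)"
proof -
  have "level_integral \<gamma> q f lam x
      \<le> (\<integral>\<^sup>+y. indicator {y. r \<le> \<bar>x - y\<bar>} y * ennreal (\<bar>x - y\<bar> powr (\<gamma> - 1)) \<partial>lebesgue)"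
    unfolding level_integral_def
  proof (intro nn_integral_mono mult_right_mono)
    fix y show "indicator (E_set lam (\<gamma> / q) f) (x, y) \<le> (indicator {y. r \<le> \<bar>x - y\<bar>} y :: ennreal)"
      using assms(3) assms(4)[of y] by (cases "\<bar>x - y\<bar> < r") (auto simp: E_set_def indicator_def)
  qed auto
  with nn_integral_powr_outside[OF assms(1,2)] show ?thesis by simp
qed

text \<open>For \<open>y\<close> within \<open>\<delta>\<close> of \<open>x\<close>, membership in
  the level set forces \<open>lam * h powr (\<gamma> / q) < S\<close> with
  \<open>h = \<bar>x - y\<bar>\<close>. As \<open>\<gamma> < 0\<close>, this keeps \<open>h\<close>
  away from 0; all other \<open>y\<close> are at distance at least \<open>\<delta>\<close>.\<close>

lemma level_integral_near:
  assumes \<gamma>: "\<gamma> < 0" and pos: "0 < q" "0 < \<delta>" "0 < lam" "0 < S"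
    and lip: "\<And>y. \<bar>x - y\<bar> < \<delta> \<Longrightarrow> \<bar>f x - f y\<bar> \<le> S * \<bar>x - y\<bar>"
  shows "level_integral \<gamma> q f lam x \<le> ennreal (- 2 / \<gamma> * ((S / lam) powr q + \<delta> powr \<gamma>))"
proof -
  \<comment> \<open>The critical distance, at which
    \<open>lam * r powr (\<gamma> / q) = S\<close>.\<close>
  define r where "r = (S / lam) powr (q / \<gamma>)"
  have r: "0 < r" using pos by (simp add: r_def)
  have r_powr: "r powr \<gamma> = (S / lam) powr q"
    using \<gamma> by (simp add: r_def powr_powr)
  let ?o = "\<lambda>r y. indicator {y. r \<le> \<bar>x - y\<bar>} y * ennreal (\<bar>x - y\<bar> powr (\<gamma> - 1))"
  have "level_integral \<gamma> q f lam x \<le> (\<integral>\<^sup>+y. ?o r y + ?o \<delta> y \<partial>lebesgue)"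
    unfolding level_integral_def distrib_right[symmetric]
  proof (intro nn_integral_mono mult_right_mono)
    fix y
    show "indicator (E_set lam (\<gamma> / q) f) (x, y)
        \<le> (indicator {y. r \<le> \<bar>x - y\<bar>} y + indicator {y. \<delta> \<le> \<bar>x - y\<bar>} y :: ennreal)"
    proof (cases "(x, y) \<in> E_set lam (\<gamma> / q) f \<and> \<bar>x - y\<bar> < \<delta>")
      case True
      define h where "h = \<bar>x - y\<bar>"
      have h: "0 < h" and E: "lam < \<bar>f x - f y\<bar> / h powr (1 + \<gamma> / q)"
        using True by (auto simp: E_set_def h_def)
      have "lam * (h * h powr (\<gamma> / q)) = lam * h powr (1 + \<gamma> / q)"
        using h by (simp add: powr_add)
      also have "\<dots> < \<bar>f x - f y\<bar>" using E h by (simp add: pos_less_divide_eq)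
      also have "\<dots> \<le> S * h" using lip[of y] True by (simp add: h_def)
      finally have "h * (lam * h powr (\<gamma> / q)) < h * S" by (simp add: mult_ac)
      then have "h powr (\<gamma> / q) < S / lam"
        using h pos by (simp add: pos_less_divide_eq mult.commute)
      \<comment> \<open>The exponent \<open>q / \<gamma>\<close> is negative and reverses the
        inequality, giving \<open>r < h\<close>.\<close>
      then have "(S / lam) powr (q / \<gamma>) < (h powr (\<gamma> / q)) powr (q / \<gamma>)"
        using h \<gamma> pos by (intro powr_less_mono2_neg) (auto simp: divide_pos_neg)
      also have "\<dots> = h" using h \<gamma> pos by (simp add: powr_powr)
      finally show ?thesis by (simp add: r_def h_def indicator_def)
    next
      case False
      then show ?thesis by (auto simp: indicator_def)
    qed
  qed auto
  also have "\<dots> = (\<integral>\<^sup>+y. ?o r y \<partial>lebesgue) + (\<integral>\<^sup>+y. ?o \<delta> y \<partial>lebesgue)"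
    by (rule nn_integral_add; rule measurable_completion; measurable)
  also have "\<dots> = ennreal (- 2 / \<gamma> * r powr \<gamma>) + ennreal (- 2 / \<gamma> * \<delta> powr \<gamma>)"
    using \<gamma> r pos by (simp only: nn_integral_powr_outside)
  also have "\<dots> = ennreal (- 2 / \<gamma> * r powr \<gamma> + - 2 / \<gamma> * \<delta> powr \<gamma>)"
    using \<gamma> by (intro ennreal_plus[symmetric]) (auto simp: divide_nonneg_neg)
  also have "- 2 / \<gamma> * r powr \<gamma> + - 2 / \<gamma> * \<delta> powr \<gamma> = - 2 / \<gamma> * ((S / lam) powr q + \<delta> powr \<gamma>)"
    by (simp add: r_powr algebra_simps)
  finally show ?thesis .
qed

section \<open>A pointwise bound uniform in the base point\<close>

lemma enn2real_enn_powr: "a < \<infinity> \<Longrightarrow> enn2real (enn_powr a r) = enn2real a powr r"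
  by (auto simp: enn_powr_def)

text \<open>Taking the \<open>q\<close>-th root leaves a factor \<open>1 / lam\<close>, which
  cancels the outer \<open>lam\<close>.\<close>

lemma scaled_enn_powr_le:
  assumes "g \<le> ennreal (k * (T / lam) powr q)" "0 < q" "0 \<le> k" "0 \<le> T" "0 < lam"
  shows "lam * enn2real (enn_powr g (1 / q)) \<le> k powr (1 / q) * T"
proof -
  have "g < \<infinity>" using assms(1) by (rule le_less_trans) simp
  then have "enn2real (enn_powr g (1 / q)) = enn2real g powr (1 / q)" by (rule enn2real_enn_powr)
  also have "\<dots> \<le> (k * (T / lam) powr q) powr (1 / q)"
    using enn2real_mono[OF assms(1)] assms(2-5) by (intro powr_mono2) auto
  also have "\<dots> = k powr (1 / q) * (T / lam)"
    using assms(2-5) by (simp add: powr_mult powr_powr)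
  finally show ?thesis using assms(5) by (simp add: field_simps)
qed

text \<open>The difference of the two powers is continuous and positive on the compact interval
  \<open>{0..L}\<close>, so its minimum serves as \<open>\<nu>\<close>. This lets a small additive
  error be absorbed into the base of the power, for every positive \<open>q\<close> alike.\<close>

lemma uniform_powr_gap:
  fixes q \<eta> L :: real
  assumes "0 < q" "0 < \<eta>" "0 \<le> L"
  obtains \<nu> where "0 < \<nu>" "\<And>A. 0 \<le> A \<Longrightarrow> A \<le> L \<Longrightarrow> (A + \<eta> / 2) powr q + \<nu> \<le> (A + \<eta>) powr q"
proof -
  define \<phi> where "\<phi> A = (A + \<eta>) powr q - (A + \<eta> / 2) powr q" for A
  have "continuous_on {0..L} \<phi>"
    unfolding \<phi>_def using assms by (intro continuous_intros) auto
  then obtain A0 where A0: "A0 \<in> {0..L}" "\<And>A. A \<in> {0..L} \<Longrightarrow> \<phi> A0 \<le> \<phi> A"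
    using continuous_attains_inf[of "{0..L}" \<phi>] assms(3) by auto
  show thesis
  proof (rule that[of "\<phi> A0"])
    show "0 < \<phi> A0"
      using A0(1) assms unfolding \<phi>_def by (simp add: powr_less_mono2)
    show "(A + \<eta> / 2) powr q + \<phi> A0 \<le> (A + \<eta>) powr q" if "0 \<le> A" "A \<le> L" for A
      using A0(2)[of A] that by (simp add: \<phi>_def)
  qed
qed

lemma mean_value_abs:
  fixes f f' :: "real \<Rightarrow> real"
  assumes "\<And>x. (f has_real_derivative f' x) (at x)"
  obtains z where "\<bar>x - z\<bar> \<le> \<bar>x - y\<bar>" "\<bar>f x - f y\<bar> = \<bar>f' z\<bar> * \<bar>x - y\<bar>"
proof (cases x y rule: linorder_cases)
  case less
  then obtain z where "x < z" "z < y" "f y - f x = (y - x) * f' z"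
    using MVT2[of x y f f'] assms by blast
  then show ?thesis
    by (intro that[of z]) (auto simp: abs_minus_commute[of "f x"] abs_minus_commute[of x y] abs_mult)
next
  case greater
  then obtain z where "y < z" "z < x" "f x - f y = (x - y) * f' z"
    using MVT2[of y x f f'] assms by blast
  then show ?thesis by (intro that[of z]) (auto simp: abs_mult)
qed (use that in auto)

text \<open>For \<open>\<bar>x\<bar> \<le> R + 1\<close>, uniform continuity of \<open>f'\<close>
  makes \<open>\<bar>f' x\<bar> + \<eta> / 2\<close> a local Lipschitz constant. Farther out,
  \<open>f\<close> is constant on a neighbourhood of \<open>x\<close> of size proportional to
  \<open>\<bar>x\<bar>\<close>, which gives the tail term with its factor
  \<open>lam\<close>.\<close>

lemma scaled_level_integral_bound:
  fixes f f' :: "real \<Rightarrow> real"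
  assumes par: "\<gamma> < 0" "0 < q"
    and deriv: "\<And>x. (f has_real_derivative f' x) (at x)"
    and cont: "continuous_on UNIV f'"
    and supp: "\<forall>x. R < \<bar>x\<bar> \<longrightarrow> f' x = 0" and R: "0 < R" and \<eta>: "0 < \<eta>"
  shows "\<forall>\<^sub>F lam in at_right 0. \<forall>x. level_integral \<gamma> q f lam x < \<infinity> \<and>
    lam * enn2real (enn_powr (level_integral \<gamma> q f lam x) (1 / q))
    \<le> (- 2 / \<gamma>) powr (1 / q) * (\<bar>f' x\<bar> + \<eta> * indicator {-(R + 1)..R + 1} x
        + lam * ((R + 1) powr (- \<gamma> / q) * (if 1 < \<bar>x\<bar> then \<bar>x\<bar> powr (\<gamma> / q) else 0)))"
proof -
  let ?c = "(- 2 / \<gamma>) powr (1 / q)"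
  have k: "0 \<le> - 2 / \<gamma>" using par by (simp add: divide_nonneg_neg)
  have "compact (f' ` {-(R + 1)..R + 1})"
    by (intro compact_continuous_image continuous_on_subset[OF cont]) auto
  then have "bounded (f' ` {-(R + 1)..R + 1})" by (rule compact_imp_bounded)
  then obtain L where L: "0 < L" "\<And>x. \<bar>x\<bar> \<le> R + 1 \<Longrightarrow> \<bar>f' x\<bar> \<le> L"
    unfolding bounded_pos by (auto simp: abs_le_iff)
  obtain \<nu> where \<nu>: "0 < \<nu>" "\<And>A. 0 \<le> A \<Longrightarrow> A \<le> L \<Longrightarrow> (A + \<eta> / 2) powr q + \<nu> \<le> (A + \<eta>) powr q"
    using uniform_powr_gap[OF par(2) \<eta>, of L] L(1) by auto
  \<comment> \<open>The extra unit beyond \<open>R + 1\<close> holds the intermediate points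
    \<open>z\<close>, which lie within \<open>\<delta> \<le> 1\<close> of \<open>x\<close>.\<close>
  have "uniformly_continuous_on {-(R + 2)..R + 2} f'"
    by (intro compact_uniformly_continuous continuous_on_subset[OF cont]) auto
  then obtain \<delta>0 where \<delta>0: "0 < \<delta>0" "\<And>x z. x \<in> {-(R + 2)..R + 2} \<Longrightarrow> z \<in> {-(R + 2)..R + 2} \<Longrightarrow>
      dist z x < \<delta>0 \<Longrightarrow> dist (f' z) (f' x) < \<eta> / 2"
    unfolding uniformly_continuous_on_def using \<eta> by (metis half_gt_zero)
  define \<delta> where "\<delta> = min \<delta>0 1"
  have \<delta>: "0 < \<delta>" "\<delta> \<le> \<delta>0" "\<delta> \<le> 1" using \<delta>0(1) by (auto simp: \<delta>_def)
  \<comment> \<open>How small \<open>lam\<close> must be depends only on \<open>\<delta>\<close> and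
    \<open>\<nu>\<close>, not on \<open>x\<close>, so the final bound holds for all \<open>x\<close>
    at once.\<close>
  have "((\<lambda>lam. lam powr q * \<delta> powr \<gamma>) \<longlongrightarrow> 0 powr q * \<delta> powr \<gamma>) (at_right 0)"
    using par(2) by (intro tendsto_intros tendsto_powr' ) (auto simp: eventually_at_filter)
  then have "\<forall>\<^sub>F lam in at_right 0. lam powr q * \<delta> powr \<gamma> < \<nu>"
    using \<nu>(1) by (intro order_tendstoD(2)) auto
  moreover have "\<forall>\<^sub>F lam in at_right (0::real). 0 < lam" by (simp add: eventually_at_right_less)
  ultimately show ?thesis
  proof eventually_elim
    case (elim lam)
    then have lam: "0 < lam" by simp
    show ?case
    proof
      fix x
      let ?G = "level_integral \<gamma> q f lam x"
      let ?far = "(R + 1) powr (- \<gamma> / q) * (if 1 < \<bar>x\<bar> then \<bar>x\<bar> powr (\<gamma> / q) else 0)"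
      \<comment> \<open>Both regimes are brought to the form required by
        \<open>scaled_enn_powr_le\<close>.\<close>
      have "\<exists>T\<ge>0. ?G \<le> ennreal (- 2 / \<gamma> * (T / lam) powr q) \<and>
          T \<le> \<bar>f' x\<bar> + \<eta> * indicator {-(R + 1)..R + 1} x + lam * ?far"
      proof (cases "\<bar>x\<bar> \<le> R + 1")
        case True
        define S where "S = \<bar>f' x\<bar> + \<eta> / 2"
        have S: "0 < S" using \<eta> by (simp add: S_def add_nonneg_pos)
        have lip: "\<bar>f x - f y\<bar> \<le> S * \<bar>x - y\<bar>" if y: "\<bar>x - y\<bar> < \<delta>" for y
        proof -
          obtain z where z: "\<bar>x - z\<bar> \<le> \<bar>x - y\<bar>" "\<bar>f x - f y\<bar> = \<bar>f' z\<bar> * \<bar>x - y\<bar>"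
            using mean_value_abs[OF deriv] by blast
          have "dist (f' z) (f' x) < \<eta> / 2"
            using True z(1) y \<delta> by (intro \<delta>0(2)) (auto simp: dist_real_def)
          then have "\<bar>f' z\<bar> \<le> S" unfolding S_def dist_real_def by linarith
          then show ?thesis unfolding z(2) by (rule mult_right_mono) simp
        qed
        \<comment> \<open>Over the common denominator \<open>lam powr q\<close> the part beyond
          \<open>\<delta>\<close> becomes
          \<open>lam powr q * \<delta> powr \<gamma> < \<nu>\<close>, which is paid for by raising
          \<open>\<eta> / 2\<close> to \<open>\<eta>\<close>.\<close>
        have "(S / lam) powr q + \<delta> powr \<gamma> = (S powr q + lam powr q * \<delta> powr \<gamma>) / lam powr q"
          using S lam by (simp add: powr_divide add_divide_distrib)
        also have "\<dots> \<le> (\<bar>f' x\<bar> + \<eta>) powr q / lam powr q"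
          using \<nu>(2)[of "\<bar>f' x\<bar>"] L(2)[OF True] elim(1)
          by (intro divide_right_mono) (auto simp: S_def)
        also have "\<dots> = ((\<bar>f' x\<bar> + \<eta>) / lam) powr q"
          using \<eta> lam by (simp add: powr_divide)
        finally have "- 2 / \<gamma> * ((S / lam) powr q + \<delta> powr \<gamma>) \<le> - 2 / \<gamma> * ((\<bar>f' x\<bar> + \<eta>) / lam) powr q"
          using k by (rule mult_left_mono)
        with level_integral_near[OF par(1,2) \<delta>(1) lam S lip]
        have "?G \<le> ennreal (- 2 / \<gamma> * ((\<bar>f' x\<bar> + \<eta>) / lam) powr q)"
          by (meson ennreal_leI order_trans)
        moreover have "\<bar>f' x\<bar> + \<eta> \<le> \<bar>f' x\<bar> + \<eta> * indicator {-(R + 1)..R + 1} x + lam * ?far"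
          using True lam by (auto simp: abs_le_iff indicator_def)
        ultimately show ?thesis using \<eta> by (intro exI[of _ "\<bar>f' x\<bar> + \<eta>"]) auto
      next
        case False
        \<comment> \<open>Proportional to \<open>\<bar>x\<bar>\<close>, so that
          \<open>r powr \<gamma>\<close> is a multiple of
          \<open>\<bar>x\<bar> powr \<gamma>\<close>, yet at most \<open>\<bar>x\<bar> - R\<close>,
          so that the interval around \<open>x\<close> avoids the support of
          \<open>f'\<close>.\<close>
        define r where "r = \<bar>x\<bar> / (R + 1)"
        have r: "0 < r" using False R by (simp add: r_def)
        have "\<bar>x\<bar> - R - r = (\<bar>x\<bar> - (R + 1)) * R / (R + 1)"
          using R by (simp add: r_def field_simps)
        also have "\<dots> \<ge> 0" using False R by simp
        finally have rle: "r \<le> \<bar>x\<bar> - R" by simp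
        have const: "f y = f x" if y: "\<bar>x - y\<bar> < r" for y
        proof -
          obtain z where z: "\<bar>x - z\<bar> \<le> \<bar>x - y\<bar>" "\<bar>f x - f y\<bar> = \<bar>f' z\<bar> * \<bar>x - y\<bar>"
            using mean_value_abs[OF deriv] by blast
          have "R < \<bar>z\<bar>" using z(1) y rle by linarith
          with z(2) show ?thesis by (simp add: supp)
        qed
        have "?G \<le> ennreal (- 2 / \<gamma> * r powr \<gamma>)"
          using lam by (intro level_integral_far[OF par(1) r] const) auto
        also have "r powr \<gamma> = ((lam * ?far) / lam) powr q"
          using False R lam par
          by (simp add: r_def powr_mult powr_powr powr_divide powr_minus_divide)
        finally have "?G \<le> ennreal (- 2 / \<gamma> * ((lam * ?far) / lam) powr q)" .
        moreover have "0 \<le> lam * ?far" using lam by simp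
        moreover have "lam * ?far \<le> \<bar>f' x\<bar> + \<eta> * indicator {-(R + 1)..R + 1} x + lam * ?far"
          using \<eta> by simp
        ultimately show ?thesis by blast
      qed
      then obtain T where T: "0 \<le> T" "?G \<le> ennreal (- 2 / \<gamma> * (T / lam) powr q)"
        "T \<le> \<bar>f' x\<bar> + \<eta> * indicator {-(R + 1)..R + 1} x + lam * ?far" by blast
      have "?G < \<infinity>" using T(2) by (rule le_less_trans) simp
      moreover have "lam * enn2real (enn_powr ?G (1 / q)) \<le> ?c * T"
        using T par(2) k lam by (intro scaled_enn_powr_le) auto
      moreover have "?c * T \<le> ?c * (\<bar>f' x\<bar> + \<eta> * indicator {-(R + 1)..R + 1} x + lam * ?far)"
        using T(3) by (rule mult_left_mono) simp
      ultimately show "?G < \<infinity> \<and> lam * enn2real (enn_powr ?G (1 / q))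
          \<le> ?c * (\<bar>f' x\<bar> + \<eta> * indicator {-(R + 1)..R + 1} x + lam * ?far)"
        by linarith
    qed
  qed
qed

text \<open>The pointwise bound passes to norms by monotonicity, homogeneity and the triangle
  inequality. The inner integral is finite everywhere, so \<open>ext_norm\<close> is the plain norm
  of its real-valued root.\<close>

lemma scaled_norm_level_integral_bound:
  fixes f f' :: "real \<Rightarrow> real"
  assumes N: "ball_bfs N" and par: "\<gamma> < 0" "0 < q"
    and deriv: "\<And>x. (f has_real_derivative f' x) (at x)"
    and cont: "continuous_on UNIV f'"
    and supp: "\<forall>x. R < \<bar>x\<bar> \<longrightarrow> f' x = 0" and R: "0 < R" and \<eta>: "0 < \<eta>"
  shows "\<forall>\<^sub>F lam in at_right 0.
    ennreal lam * ext_norm N (\<lambda>x. enn_powr (level_integral \<gamma> q f lam x) (1 / q))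
    \<le> ennreal ((- 2 / \<gamma>) powr (1 / q)) * (N f' + ennreal \<eta> * N (indicator {-(R + 1)..R + 1})
        + ennreal (lam * (R + 1) powr (- \<gamma> / q)) * N (\<lambda>x. if 1 < \<bar>x\<bar> then \<bar>x\<bar> powr (\<gamma> / q) else 0))"
proof -
  define d where "d x = (if 1 < \<bar>x\<bar> then \<bar>x\<bar> powr (\<gamma> / q) else 0)" for x :: real
  define B where "B = {-(R + 1)..R + 1}"
  define c where "c = (- 2 / \<gamma>) powr (1 / q)"
  define D where "D = (R + 1) powr (- \<gamma> / q)"
  have [measurable]: "f' \<in> borel_measurable lebesgue"
    by (rule measurable_completion) (use cont in \<open>simp add: borel_measurable_continuous_onI\<close>)
  have [measurable]: "d \<in> borel_measurable lebesgue"
    unfolding d_def by (rule measurable_completion) measurable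
  have mB: "meas_fun (indicator B)"
    by (rule meas_fun_indicator)
      (simp add: B_def bounded_interval_def is_interval_convex convex_real_interval)
  then have [measurable]: "(indicator B :: real \<Rightarrow> real) \<in> borel_measurable lebesgue" by (rule meas_funD)
  have "continuous_on UNIV f"
    using deriv by (intro continuous_at_imp_continuous_on) (auto intro: DERIV_isCont)
  then have [measurable]: "level_integral \<gamma> q f lam \<in> borel_measurable lebesgue" for lam
    by (rule measurable_level_integral)
  have "\<forall>\<^sub>F lam in at_right (0::real). 0 < lam" by (simp add: eventually_at_right_less)
  with scaled_level_integral_bound[OF par deriv cont supp R \<eta>] show ?thesis
  proof eventually_elim
    case (elim lam)
    define G where "G x = enn2real (enn_powr (level_integral \<gamma> q f lam x) (1 / q))" for x
    have fin: "enn_powr (level_integral \<gamma> q f lam x) (1 / q) < \<infinity>" for x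
      using elim(1) by (auto simp: enn_powr_def less_top[symmetric])
    have [measurable]: "G \<in> borel_measurable lebesgue"
    proof -
      have "G = (\<lambda>x. enn2real (level_integral \<gamma> q f lam x) powr (1 / q))"
        unfolding G_def using elim(1) by (intro ext enn2real_enn_powr) auto
      then show ?thesis by simp
    qed
    have bound: "lam * G x \<le> c * (\<bar>f' x\<bar> + \<eta> * indicator B x + lam * D * d x)" for x
      using elim(1) by (simp add: G_def c_def B_def D_def d_def mult.assoc)
    have nonneg: "0 \<le> lam * G x" for x using elim(2) by (simp add: G_def)
    have c: "0 \<le> c" and D: "0 \<le> lam * D" using elim(2) by (simp_all add: c_def D_def)
    have "ennreal lam * ext_norm N (\<lambda>x. enn_powr (level_integral \<gamma> q f lam x) (1 / q)) = ennreal lam * N G"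
      using fin by (simp add: ext_norm_def G_def[abs_def])
    also have "\<dots> = N (\<lambda>x. lam * G x)"
      using elim(2) by (subst bfs_scale[OF N]) (auto simp: meas_fun_def)
    also have "\<dots> \<le> N (\<lambda>x. c * (\<bar>f' x\<bar> + \<eta> * indicator B x + lam * D * d x))"
    proof (rule bfs_mono[OF N])
      show "\<bar>lam * G x\<bar> \<le> \<bar>c * (\<bar>f' x\<bar> + \<eta> * indicator B x + lam * D * d x)\<bar>" for x
        using bound[of x] nonneg[of x] by linarith
    qed (auto simp: meas_fun_def)
    also have "\<dots> = ennreal c * N (\<lambda>x. \<bar>f' x\<bar> + \<eta> * indicator B x + lam * D * d x)"
      using c by (subst bfs_scale[OF N]) (auto simp: meas_fun_def)
    also have "\<dots> \<le> ennreal c * (N (\<lambda>x. \<bar>f' x\<bar> + \<eta> * indicator B x) + N (\<lambda>x. lam * D * d x))"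
      by (intro mult_left_mono bfs_triangle[OF N]) (auto simp: meas_fun_def)
    also have "\<dots> \<le> ennreal c * ((N (\<lambda>x. \<bar>f' x\<bar>) + N (\<lambda>x. \<eta> * indicator B x)) + N (\<lambda>x. lam * D * d x))"
      by (intro mult_left_mono add_right_mono bfs_triangle[OF N]) (auto simp: meas_fun_def)
    also have "\<dots> \<le> ennreal c * ((N f' + N (\<lambda>x. \<eta> * indicator B x)) + N (\<lambda>x. lam * D * d x))"
      by (intro mult_left_mono add_right_mono bfs_mono[OF N]) (auto simp: meas_fun_def)
    also have "N (\<lambda>x. \<eta> * indicator B x) = ennreal \<eta> * N (indicator B)"
      using bfs_scale[OF N mB, of \<eta>] \<eta> by simp
    also have "N (\<lambda>x. lam * D * d x) = ennreal (lam * D) * N d"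
      using bfs_scale[OF N, of d "lam * D"] D by (simp add: meas_fun_def)
    finally show ?case by (simp add: c_def B_def D_def d_def[abs_def])
  qed
qed

section \<open>The limit as lambda tends to zero\<close>

lemma Limsup_le_of_eventually_le_plus:
  fixes F :: "'a \<Rightarrow> ennreal"
  assumes "\<And>e. 0 < e \<Longrightarrow> \<forall>\<^sub>F x in A. F x \<le> K + ennreal e"
  shows "Limsup A F \<le> K"
proof (rule ennreal_le_epsilon)
  fix e :: real assume "0 < e"
  then show "Limsup A F \<le> K + ennreal e" by (intro Limsup_bounded assms)
qed

theorem theorem3p25:
  fixes N :: fnorm and p \<gamma> q :: real and f f' :: "real \<Rightarrow> real"
  assumes "ball_bfs N"
    and "1 \<le> p" and "\<gamma> < 0" and "0 < q" and "q < - p * \<gamma>"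
    and "ball_bfs (power_norm N (1 / p))"
    and "maximal_bounded_on (assoc_norm (power_norm N (1 / p)))"
    and "\<And>x. (f has_real_derivative f' x) (at x)"
    and "continuous_on UNIV f'"
    and "bounded {x. f' x \<noteq> 0}"
  shows "Limsup (at_right 0) (\<lambda>lam. ennreal lam *
            ext_norm N (\<lambda>x. enn_powr
              (\<integral>\<^sup>+y. indicator (E_set lam (\<gamma> / q) f) (x, y) * ennreal (\<bar>x - y\<bar> powr (\<gamma> - 1)) \<partial>lebesgue)
              (1 / q)))
         \<le> ennreal ((- kappa1 q / \<gamma>) powr (1 / q)) * N f'"
proof -
  define c where "c = (- 2 / \<gamma>) powr (1 / q)"
  have kappa: "(- kappa1 q / \<gamma>) powr (1 / q) = c" by (simp add: kappa1_def c_def)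
  obtain R where R: "0 < R" "\<forall>x. R < \<bar>x\<bar> \<longrightarrow> f' x = 0"
    using assms(10) unfolding bounded_pos by (auto simp: not_le[symmetric])
  define D where "D = (R + 1) powr (- \<gamma> / q)"
  have "N (indicator {-(R + 1)..R + 1}) < \<infinity>"
    by (rule bfs_indicator_finite[OF assms(1)])
      (simp add: bounded_interval_def is_interval_convex convex_real_interval)
  then obtain b where b: "0 \<le> b" "N (indicator {-(R + 1)..R + 1}) = ennreal b"
    by (metis enn2real_nonneg ennreal_enn2real infinity_ennreal_def)
  \<comment> \<open>The assumption on the maximal operator and the upper bound on \<open>q\<close>
    enter through the finiteness of this norm.\<close>
  obtain d where d: "0 \<le> d" "N (\<lambda>x. if 1 < \<bar>x\<bar> then \<bar>x\<bar> powr (\<gamma> / q) else 0) = ennreal d"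
    using bfs_decay_finite[OF assms(2-7)]
    by (metis enn2real_nonneg ennreal_enn2real infinity_ennreal_def)
  have c: "0 \<le> c" and D: "0 \<le> D" by (simp_all add: c_def D_def)
  show ?thesis
    unfolding kappa level_integral_def[symmetric]
  proof (rule Limsup_le_of_eventually_le_plus)
    fix e :: real assume e: "0 < e"
    \<comment> \<open>Chosen so that \<open>c * (\<eta> * b) \<le> e / 2\<close>; the summand 1
      covers the case \<open>c * b = 0\<close>.\<close>
    define \<eta> where "\<eta> = e / (2 * (c * b + 1))"
    have \<eta>: "0 < \<eta>" using e c b by (simp add: \<eta>_def add_nonneg_pos)
    have "c * (\<eta> * b) = e / 2 * (c * b / (c * b + 1))" by (simp add: \<eta>_def)
    also have "\<dots> \<le> e / 2 * 1"
      using e c b by (intro mult_left_mono) (auto simp: divide_le_eq add_nonneg_pos)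
    finally have \<eta>_le: "c * (\<eta> * b) \<le> e / 2" by simp
    \<comment> \<open>As \<open>d\<close> is finite, the tail contribution vanishes with
      \<open>lam\<close> and uses up the other half of \<open>e\<close>.\<close>
    have "((\<lambda>lam. c * (lam * D * d)) \<longlongrightarrow> c * (0 * D * d)) (at_right 0)" by (intro tendsto_intros)
    then have "\<forall>\<^sub>F lam in at_right 0. c * (lam * D * d) < e / 2"
      using e by (intro order_tendstoD(2)) auto
    moreover have "\<forall>\<^sub>F lam in at_right (0::real). 0 < lam" by (simp add: eventually_at_right_less)
    moreover note scaled_norm_level_integral_bound[OF assms(1,3,4,8,9) R(2,1) \<eta>]
    ultimately show "\<forall>\<^sub>F lam in at_right 0. ennreal lam *
        ext_norm N (\<lambda>x. enn_powr (level_integral \<gamma> q f lam x) (1 / q)) \<le> ennreal c * N f' + ennreal e"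
    proof eventually_elim
      case (elim lam)
      note elim(3)
      also have "ennreal ((- 2 / \<gamma>) powr (1 / q)) * (N f' + ennreal \<eta> * N (indicator {-(R + 1)..R + 1})
        + ennreal (lam * (R + 1) powr (- \<gamma> / q)) * N (\<lambda>x. if 1 < \<bar>x\<bar> then \<bar>x\<bar> powr (\<gamma> / q) else 0))
        = ennreal c * N f' + ennreal (c * (\<eta> * b) + c * (lam * D * d))"
        unfolding b(2) d(2) c_def[symmetric] D_def[symmetric]
        using b(1) d(1) c D elim(2) \<eta>
        by (simp add: ennreal_mult[symmetric] ennreal_plus distrib_left add.assoc)
      also have "\<dots> \<le> ennreal c * N f' + ennreal e"
        using \<eta>_le elim(1) by (intro add_left_mono ennreal_leI) simp
      finally show ?case .
    qed
  qed
qed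

end
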